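(* For any non-singular real cubic surface $X\subset P^3$, $$h=\mathcal N^+_{\mathbb R},\qquad e=\mathcal N^-_{\mathbb R},$$ where $h$ and $e$ are the numbers of hyperbolic and elliptic real lines on $X$, respectively, and $\mathcal N^{+}_{\mathbb R}$ and $\mathcal N^-_{\mathbb R}$ are the numbers of real lines $\ell\subset X$ of index $I^e_\ell(s_f)=1$ and $I^e_\ell(s_f)=-1$, respectively, $f$ being a real homogeneous cubic polynomial defining $X$.
   Context: Hyperbolic and elliptic lines (Segre). Let $\ell$ be a real line on a non-singular real cubic surface $X$. Choose real projective coordinates $x,y,u,v$ in $P^3$ so that $\ell$ is given by $x=y=0$. Then the polynomial defining $X$ has the form $f=u^2L_{11}+2uvL_{12}+v^2L_{22}+uQ_1+vQ_2+C$, where $L_{ij},Q_i,C$ are homogeneous polynomials in $x,y$ of degrees one, two, three, respectively. The line $\ell$ is elliptic (respectively, hyperbolic) if the binary quadratic form $L_{12}^2-L_{11}L_{22}$ in $x,y$ is definite (respectively, indefinite). Index. $G_2(\mathbb R^4)$ is the Grassmannian of real 2-planes in $\mathbb R^4$, $\tau_{2,4}$ its tautological 2-plane bundle, and $s_f$ is the section of $Sym^3(\tau_{2,4}^* )$ given by $s_f(p)=f|_p\in Sym^3(p^* )$; its zeros are the real lines on $X$. For non-singular $X$ the section $s_f$ is transversal to the zero section, so all indices are $\pm1$. The total space $E$ of $Sym^3(\tau_{2,4}^* )$ is oriented as follows. Let $Q^2(\mathbb C)\subset P^3(\mathbb C)$ be the quadric $x_0^2+x_1^2+x_2^2+x_3^2=0$,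 with tautological line bundle $\tau_2$ (fibre $L_q\subset\mathbb C^4$ over $q$). Oriented real 2-planes $p\subset\mathbb R^4$ correspond diffeomorphically to points $q\in Q^2(\mathbb C)$, where $p$ is the image of $L_q$ under $v\mapsto\frac12(v+\bar v)$ with the pushed-forward complex orientation; reversal of orientation corresponds to $q\mapsto\bar q$. Identifying $p$ with $L_q$ by averaging, $Sym^3(p^* )$ is the real part of $(L_q^* )^3\oplus(L_q^* )^2\bar L_q^*\oplus L_q^*(\bar L_q^* )^2\oplus(\bar L_q^* )^3$, and $v\mapsto\frac12(v+\bar v)$ gives a real isomorphism from $(L_q^* )^{3}\oplus(L_q^* )^{2}\bar L_q^*$ onto $Sym^{3}(p^* )$. This identifies $E$ with the quotient by complex conjugation of the total space of the complex bundle $(\tau_2^* )^{3}\oplus(\tau_2^* )^{2}\bar\tau_2^*$ over $Q^2(\mathbb C)$, whose complex orientation is conjugation-invariant and descends to $E$. For a zero $\ell$ of $s_f$, $I^e_\ell(s_f)$ is the local Euler number at $\ell$: choose local orientations of the base and of the fibre near $\ell$ which together give the orientation of $E$, and take the local degree at $\ell$ of $s_f$ in a local trivialization (here, the sign of its Jacobian determinant). *)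

theory Defs
  imports "HOL-Analysis.Analysis" "HOL-Library.Poly_Mapping"
begin

section \<open>Real cubic surfaces and their real lines\<close>

text \<open>
  A polynomial in four variables maps exponent vectors to coefficients. A real polynomial is
  evaluated both at real and at complex points.
\<close>

type_synonym poly4 = "(4 \<Rightarrow>\<^sub>0 nat) \<Rightarrow>\<^sub>0 real"

definition homogeneous :: "nat \<Rightarrow> poly4 \<Rightarrow> bool" where
  "homogeneous d f \<longleftrightarrow>
     (\<forall>m\<in>Poly_Mapping.keys f. (\<Sum>i\<in>UNIV. Poly_Mapping.lookup m i) = d)"

definition eval_poly :: "poly4 \<Rightarrow> 'a::real_field ^ 4 \<Rightarrow> 'a" where
  "eval_poly f x =
     (\<Sum>m\<in>Poly_Mapping.keys f. of_real (Poly_Mapping.lookup f m)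
                                  * (\<Prod>i\<in>UNIV. x $ i ^ Poly_Mapping.lookup m i))"

text \<open>
  Non-singularity is that of the complex surface: there is no complex projective point at which
  the polynomial and all its partial derivatives vanish.
\<close>

definition nonsingular :: "poly4 \<Rightarrow> bool" where
  "nonsingular f \<longleftrightarrow>
     \<not> (\<exists>z::complex^4. z \<noteq> 0 \<and> eval_poly f z = 0 \<and>
            (\<forall>i. deriv (\<lambda>t. eval_poly f (z + axis i t)) 0 = 0))"

text \<open>A line of real projective space is a 2-plane in the vector space, i.e. a point of the
  Grassmannian.\<close>

definition real_lines :: "poly4 \<Rightarrow> (real^4) set set" where
  "real_lines f = {p. subspace p \<and> dim p = 2 \<and> (\<forall>x\<in>p. eval_poly f x = 0)}"


section \<open>Hyperbolic and elliptic lines\<close>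

definition binary_form :: "nat \<Rightarrow> (real \<Rightarrow> real \<Rightarrow> real) \<Rightarrow> bool" where
  "binary_form d g \<longleftrightarrow> (\<exists>c. \<forall>x y. g x y = (\<Sum>i\<le>d. c i * x ^ i * y ^ (d - i)))"

definition definite :: "(real \<Rightarrow> real \<Rightarrow> real) \<Rightarrow> bool" where
  "definite q \<longleftrightarrow> (\<forall>x y. (x, y) \<noteq> (0, 0) \<longrightarrow> q x y > 0) \<or> (\<forall>x y. (x, y) \<noteq> (0, 0) \<longrightarrow> q x y < 0)"

definition indefinite :: "(real \<Rightarrow> real \<Rightarrow> real) \<Rightarrow> bool" where
  "indefinite q \<longleftrightarrow> (\<exists>x y. q x y > 0) \<and> (\<exists>x y. q x y < 0)"

text \<open>
  The invertible matrix \<open>A\<close> sends the coordinates \<open>(x, y, u, v)\<close> of a point to the point itself;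
  the line is \<open>x = y = 0\<close>.
\<close>

definition adapted_expansion ::
  "poly4 \<Rightarrow> (real^4) set \<Rightarrow> (real \<Rightarrow> real \<Rightarrow> real) \<Rightarrow> (real \<Rightarrow> real \<Rightarrow> real) \<Rightarrow> (real \<Rightarrow> real \<Rightarrow> real) \<Rightarrow> bool"
  where
  "adapted_expansion f p L11 L12 L22 \<longleftrightarrow>
     binary_form 1 L11 \<and> binary_form 1 L12 \<and> binary_form 1 L22 \<and>
     (\<exists>(A::real^4^4) Q1 Q2 C.
        invertible A \<and> p = {A *v vector [0, 0, u, v] | u v. True} \<and>
        binary_form 2 Q1 \<and> binary_form 2 Q2 \<and> binary_form 3 C \<and>
        (\<forall>x y u v. eval_poly f (A *v vector [x, y, u, v]) =
           u^2 * L11 x y + 2 * u * v * L12 x y + v^2 * L22 x y + u * Q1 x y + v * Q2 x y + C x y))"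

definition elliptic :: "poly4 \<Rightarrow> (real^4) set \<Rightarrow> bool" where
  "elliptic f p \<longleftrightarrow>
     (\<exists>L11 L12 L22. adapted_expansion f p L11 L12 L22 \<and>
        definite (\<lambda>x y. (L12 x y)^2 - L11 x y * L22 x y))"

definition hyperbolic :: "poly4 \<Rightarrow> (real^4) set \<Rightarrow> bool" where
  "hyperbolic f p \<longleftrightarrow>
     (\<exists>L11 L12 L22. adapted_expansion f p L11 L12 L22 \<and>
        indefinite (\<lambda>x y. (L12 x y)^2 - L11 x y * L22 x y))"


section \<open>The local Euler number\<close>

text \<open>
  The 2-plane underlying the complex line spanned by \<open>z\<close>, its image under
  \<open>v \<mapsto> (v + cnj v) / 2\<close>.
\<close>

definition real_part :: "complex^4 \<Rightarrow> real^4" where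
  "real_part z = (\<chi> i. Re (z $ i))"

definition plane_of :: "complex^4 \<Rightarrow> (real^4) set" where
  "plane_of z = range (\<lambda>t. real_part (t *s z))"

text \<open>
  A local holomorphic frame \<open>\<zeta>\<close> of the tautological line bundle over the quadric
  \<open>x\<^sub>0\<^sup>2 + x\<^sub>1\<^sup>2 + x\<^sub>2\<^sup>2 + x\<^sub>3\<^sup>2 = 0\<close>, written in local holomorphic coordinates \<open>w\<close> of the quadric.
  The map \<open>w \<mapsto> [\<zeta> w]\<close> is required to be an injective immersion into complex projective space;
  the immersion condition is the linear independence of \<open>\<zeta> w\<close> and its two partial derivatives,
  the columns of \<open>M\<close>. Since the quadric has complex dimension two, this makes the map a holomorphic
  chart.
\<close>

definition holomorphic_frame :: "(complex^2) set \<Rightarrow> (complex^2 \<Rightarrow> complex^4) \<Rightarrow> bool" where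
  "holomorphic_frame U \<zeta> \<longleftrightarrow>
     open U \<and>
     (\<forall>w\<in>U. (\<Sum>i\<in>UNIV. (\<zeta> w $ i)^2) = 0) \<and>
     (\<forall>w\<in>U. \<forall>w'\<in>U. \<forall>c. \<zeta> w' = c *s \<zeta> w \<longrightarrow> w' = w) \<and>
     (\<forall>w\<in>U. \<exists>M::complex^2^4. (\<zeta> has_derivative (\<lambda>h. M *v h)) (at w) \<and>
                (\<forall>c h. c *s \<zeta> w + M *v h = 0 \<longrightarrow> c = 0 \<and> h = 0))"

text \<open>
  Let \<open>L\<close> be the line spanned by \<open>\<zeta> w\<close> and \<open>p\<close> the corresponding 2-plane. In the frame dual to
  \<open>\<zeta> w\<close>, the element of \<open>(L\<^sup>*)\<^sup>3 \<oplus> (L\<^sup>*)\<^sup>2 (cnj L)\<^sup>*\<close> with complex coordinates \<open>(a, b)\<close> is the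
  function \<open>t \<cdot> \<zeta> w \<mapsto> a t\<^sup>3 + b t\<^sup>2 cnj t\<close>, and the corresponding cubic form on \<open>p\<close> is its real part.
  Hence \<open>(w, a, b)\<close> are complex coordinates on the total space of the bundle, and \<open>\<sigma>\<close> below is the
  section \<open>p \<mapsto> f|\<^sub>p\<close> in this trivialization.
\<close>

definition section_in_frame ::
  "poly4 \<Rightarrow> (complex^2) set \<Rightarrow> (complex^2 \<Rightarrow> complex^4) \<Rightarrow> (complex^2 \<Rightarrow> complex^2) \<Rightarrow> bool" where
  "section_in_frame f U \<zeta> \<sigma> \<longleftrightarrow>
     (\<forall>w\<in>U. \<forall>t::complex. eval_poly f (real_part (t *s \<zeta> w)) =
        Re (\<sigma> w $ 1 * t^3 + \<sigma> w $ 2 * t^2 * cnj t))"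

text \<open>
  The determinant of a real-linear endomorphism of \<open>\<complex>\<^sup>2\<close>, computed in the real coordinates
  given by real and imaginary parts. As domain and target use the same basis, its sign compares
  the complex orientations.
\<close>

definition to_real4 :: "complex^2 \<Rightarrow> real^4" where
  "to_real4 z = vector [Re (z $ 1), Im (z $ 1), Re (z $ 2), Im (z $ 2)]"

definition of_real4 :: "real^4 \<Rightarrow> complex^2" where
  "of_real4 x = vector [Complex (x $ 1) (x $ 2), Complex (x $ 3) (x $ 4)]"

definition real_det :: "(complex^2 \<Rightarrow> complex^2) \<Rightarrow> real" where
  "real_det D = det (matrix (\<lambda>x. to_real4 (D (of_real4 x))))"

text \<open>
  The complex orientations of the base coordinates \<open>w\<close> and of the fibre coordinates \<open>(a, b)\<close>
  together give the complex orientation of the total space. The local Euler number at a zero \<open>p\<close> of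
  the section is the sign of the Jacobian determinant of the section in such coordinates. It does
  not depend on the frame, nor on which of the two points of the quadric over \<open>p\<close> the frame passes
  through.
\<close>

definition local_euler_number :: "poly4 \<Rightarrow> (real^4) set \<Rightarrow> int" where
  "local_euler_number f p =
     (THE s. \<exists>U \<zeta> \<sigma> w D.
        holomorphic_frame U \<zeta> \<and> w \<in> U \<and> plane_of (\<zeta> w) = p \<and>
        section_in_frame f U \<zeta> \<sigma> \<and> (\<sigma> has_derivative D) (at w) \<and>
        of_int s = sgn (real_det D))"

end

theory Submission
  imports Defs
begin

text \<open>
  Let \<open>T\<close> be the polarization of \<open>f\<close>, and let the line \<open>p\<close> on the surface be spanned by \<open>a\<close> and \<open>b\<close>. Both sides
  of the comparison are governed by one object, the quadratic form
  \<open>q(\<nu>) = T(a, b, \<nu>)\<^sup>2 - T(a, a, \<nu>) T(b, b, \<nu>)\<close> on the two-dimensional normal space of \<open>p\<close>. Up to a positive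
  factor it is Segre's form \<open>L\<^sub>1\<^sub>2\<^sup>2 - L\<^sub>1\<^sub>1 L\<^sub>2\<^sub>2\<close>, so the line is hyperbolic or elliptic according to whether the
  Gram determinant \<open>\<Delta>\<close> of \<open>q\<close> is negative or positive (\<open>line_type_iff_segre_disc\<close>). The determinant \<open>\<Delta>\<close> is
  also a resultant of the quadratic forms by which the normal derivatives of \<open>f\<close> restrict to \<open>p\<close>; if it
  vanished, these would have a common complex zero, a singular point of the surface (\<open>segre_disc_neq_0\<close>).

  For the index, let \<open>\<zeta> = a + i b\<close> with orthonormal \<open>a, b\<close> be a point of the quadric over \<open>p\<close>, and let \<open>c, d\<close>
  be an orthonormal basis of the normal space. The tangent space of the quadric at \<open>\<zeta>\<close> is identified with
  \<open>{n\<^sub>1 c + n\<^sub>2 d | n\<^sub>1, n\<^sub>2 \<in> \<complex>}\<close>, and in the complex coordinates of the bundle the derivative of the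
  section \<open>f|\<^sub>p\<close> is, up to the factor \<open>3/4\<close>,
  \<open>n \<mapsto> (\<alpha> \<cdot> n, \<alpha> \<cdot> cnj n + 2 \<beta> \<cdot> n)\<close> with \<open>\<alpha> = T(\<zeta>, \<zeta>, \<cdot>)\<close> and \<open>\<beta> = T(\<zeta>, cnj \<zeta>, \<cdot>)\<close> at \<open>c\<close> and \<open>d\<close>
  (\<open>section_derivative\<close>). The determinant of this real-linear map is a negative multiple of the Gram
  determinant of \<open>|\<alpha>|\<^sup>2 - \<beta>\<^sup>2\<close> (\<open>real_det_normal_form\<close>), and \<open>|\<alpha>|\<^sup>2 - \<beta>\<^sup>2 = 4 q\<close>. Hence the index is the sign of
  \<open>- \<Delta>\<close> in every frame (\<open>real_det_section\<close>), which is \<open>1\<close> for hyperbolic and \<open>-1\<close> for elliptic lines.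
  The two kinds of counts thus count the same lines.

  The non-vanishing of \<open>\<Delta>\<close> also makes every line an isolated zero of the section, and compactness of the
  Grassmannian gives finiteness (\<open>finite_real_lines\<close>).
\<close>

section \<open>The polarization of a cubic form\<close>

text \<open>
  A monomial of degree three is a product of three variables, with repetition. Writing it in this way
  turns evaluation into a sum of triple products, from which multilinearity of the polarization is
  read off; the indices depend on the exponent vector alone, so that they serve real and complex
  points alike.
\<close>

lemma lookup_monomial_factors:
  fixes m :: "4 \<Rightarrow>\<^sub>0 nat"
  assumes "(\<Sum>l\<in>UNIV. Poly_Mapping.lookup m l) = 3"
  shows "\<exists>i j k. \<forall>l. Poly_Mapping.lookup m l = of_bool (l = i) + of_bool (l = j) + of_bool (l = k)"
proof -
  have peel: "\<exists>i g'. (\<forall>l. g l = of_bool (l = i) + g' l) \<and> (\<Sum>l\<in>UNIV. g' l) = n"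
    if "(\<Sum>l\<in>UNIV. g l) = Suc n" for g :: "4 \<Rightarrow> nat" and n
  proof -
    have "\<exists>i. g i > 0"
    proof (rule ccontr)
      assume "\<nexists>i. g i > 0"
      then have "(\<Sum>l\<in>UNIV. g l) = 0" by simp
      then show False using that by simp
    qed
    then obtain i where i: "g i > 0" by blast
    let ?g' = "\<lambda>l. g l - of_bool (l = i)"
    have eq: "g l = of_bool (l = i) + ?g' l" for l using i by auto
    have "(\<Sum>l\<in>UNIV. g l) = (\<Sum>l\<in>UNIV. of_bool (l = i)) + (\<Sum>l\<in>UNIV. ?g' l)"
      by (subst eq) (rule sum.distrib)
    then have "(\<Sum>l\<in>UNIV. ?g' l) = n" using that by (simp add: of_bool_def)
    with eq show ?thesis by (intro exI[where x = i] exI[where x = ?g'] conjI allI)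
  qed
  obtain i g1 where 1: "\<And>l. Poly_Mapping.lookup m l = of_bool (l = i) + g1 l" "(\<Sum>l\<in>UNIV. g1 l) = 2"
    using peel[of "Poly_Mapping.lookup m" 2] assms by auto
  obtain j g2 where 2: "\<And>l. g1 l = of_bool (l = j) + g2 l" "(\<Sum>l\<in>UNIV. g2 l) = 1"
    using peel[of g1 1] 1(2) by auto
  obtain k g3 where 3: "\<And>l. g2 l = of_bool (l = k) + g3 l" "(\<Sum>l\<in>UNIV. g3 l) = 0"
    using peel[of g2 0] 2(2) by auto
  have "g3 l = 0" for l using 3(2) by auto
  then show ?thesis using 1 2 3 by (auto simp: add.assoc)
qed

lemma eval_poly_cubic:
  assumes "homogeneous 3 f"
  obtains i j k where
    "\<And>x :: 'a::real_field ^ 4. eval_poly f x =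
       (\<Sum>m\<in>Poly_Mapping.keys f. of_real (Poly_Mapping.lookup f m) * (x $ i m * x $ j m * x $ k m))"
proof -
  have "\<forall>m\<in>Poly_Mapping.keys f. \<exists>i j k. \<forall>l. Poly_Mapping.lookup m l
           = of_bool (l = i) + of_bool (l = j) + of_bool (l = k)"
    using assms lookup_monomial_factors unfolding homogeneous_def by blast
  then obtain i j k where ijk: "\<And>m l. m \<in> Poly_Mapping.keys f \<Longrightarrow> Poly_Mapping.lookup m l
           = of_bool (l = i m) + of_bool (l = j m) + of_bool (l = k m)"
    by metis
  have pw: "(\<Prod>l\<in>UNIV. (x::'a^4) $ l ^ of_bool (l = i)) = x $ i" for x i
  proof -
    have "(\<Prod>l\<in>UNIV. (x::'a^4) $ l ^ of_bool (l = i)) = (\<Prod>l\<in>UNIV. if l = i then x $ l else 1)"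
      by (rule prod.cong) auto
    then show ?thesis by simp
  qed
  have "eval_poly f x =
       (\<Sum>m\<in>Poly_Mapping.keys f. of_real (Poly_Mapping.lookup f m) * (x $ i m * x $ j m * x $ k m))" for x :: "'a^4"
    unfolding eval_poly_def
  proof (rule sum.cong)
    fix m assume "m \<in> Poly_Mapping.keys f"
    then have "(\<Prod>l\<in>UNIV. x $ l ^ Poly_Mapping.lookup m l) = x $ i m * x $ j m * x $ k m"
      by (simp add: ijk power_add prod.distrib pw)
    then show "of_real (Poly_Mapping.lookup f m) * (\<Prod>l\<in>UNIV. x $ l ^ Poly_Mapping.lookup m l) =
      of_real (Poly_Mapping.lookup f m) * (x $ i m * x $ j m * x $ k m)" by simp
  qed simp
  then show ?thesis using that by blast
qed

text \<open>
  The symmetric trilinear form \<open>T\<close> with \<open>T(x, x, x) = f(x)\<close>. The polarization identity defines it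
  from values of \<open>f\<close> only. This makes symmetry, the compatibility with complexification and
  conjugation, and differentiability immediate; trilinearity is what needs the degree.
\<close>

definition polar :: "poly4 \<Rightarrow> 'a::real_field ^ 4 \<Rightarrow> 'a ^ 4 \<Rightarrow> 'a ^ 4 \<Rightarrow> 'a" where
  "polar f x y z = (eval_poly f (x + y + z) - eval_poly f (x + y) - eval_poly f (x + z)
      - eval_poly f (y + z) + eval_poly f x + eval_poly f y + eval_poly f z) / 6"

lemma polar_commute: "polar f x y z = polar f y x z" "polar f x y z = polar f x z y"
  by (simp_all add: polar_def algebra_simps)

lemma polarize_product:
  fixes x1 :: "'a::comm_ring_1"
  shows "(x1 + y1 + z1) * (x2 + y2 + z2) * (x3 + y3 + z3) - (x1 + y1) * (x2 + y2) * (x3 + y3)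
      - (x1 + z1) * (x2 + z2) * (x3 + z3) - (y1 + z1) * (y2 + z2) * (y3 + z3)
      + x1 * x2 * x3 + y1 * y2 * y3 + z1 * z2 * z3
    = x1 * (y2 * z3 + z2 * y3) + y1 * (x2 * z3 + z2 * x3) + z1 * (x2 * y3 + y2 * x3)"
  by (simp add: algebra_simps)

lemma polar_expand:
  assumes "homogeneous 3 f"
  obtains i j k where
    "\<And>x y z :: 'a::real_field ^ 4. polar f x y z =
       (\<Sum>m\<in>Poly_Mapping.keys f. of_real (Poly_Mapping.lookup f m) / 6 *
         (x $ i m * (y $ j m * z $ k m + z $ j m * y $ k m) +
          y $ i m * (x $ j m * z $ k m + z $ j m * x $ k m) +
          z $ i m * (x $ j m * y $ k m + y $ j m * x $ k m)))"
proof -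
  obtain i j k where ijk: "\<And>x :: 'a ^ 4. eval_poly f x =
       (\<Sum>m\<in>Poly_Mapping.keys f. of_real (Poly_Mapping.lookup f m) * (x $ i m * x $ j m * x $ k m))"
    using eval_poly_cubic[OF assms] by blast
  have "polar f x y z =
       (\<Sum>m\<in>Poly_Mapping.keys f. of_real (Poly_Mapping.lookup f m) / 6 *
         (x $ i m * (y $ j m * z $ k m + z $ j m * y $ k m) +
          y $ i m * (x $ j m * z $ k m + z $ j m * x $ k m) +
          z $ i m * (x $ j m * y $ k m + y $ j m * x $ k m)))" for x y z :: "'a ^ 4"
    unfolding polar_def ijk sum.distrib[symmetric] sum_subtractf[symmetric] sum_divide_distrib
    by (rule sum.cong[OF refl], subst polarize_product[symmetric])
      (simp add: right_diff_distrib distrib_left[of "of_real _"] diff_divide_distrib add_divide_distrib)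
  then show ?thesis using that by blast
qed

lemma polar_add_right:
  assumes "homogeneous 3 f"
  shows "polar f x y (z + z') = polar f x y z + polar f x y z'"
proof -
  obtain i j k where ijk: "\<And>x y z :: 'a ^ 4. polar f x y z =
       (\<Sum>m\<in>Poly_Mapping.keys f. of_real (Poly_Mapping.lookup f m) / 6 *
         (x $ i m * (y $ j m * z $ k m + z $ j m * y $ k m) +
          y $ i m * (x $ j m * z $ k m + z $ j m * x $ k m) +
          z $ i m * (x $ j m * y $ k m + y $ j m * x $ k m)))"
    using polar_expand[OF assms] by blast
  show ?thesis unfolding ijk sum.distrib[symmetric]
    by (rule sum.cong) (auto simp: algebra_simps)
qed

lemma polar_scale_right:
  assumes "homogeneous 3 f"
  shows "polar f x y (c *s z) = c * polar f x y z"
proof -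
  obtain i j k where ijk: "\<And>x y z :: 'a ^ 4. polar f x y z =
       (\<Sum>m\<in>Poly_Mapping.keys f. of_real (Poly_Mapping.lookup f m) / 6 *
         (x $ i m * (y $ j m * z $ k m + z $ j m * y $ k m) +
          y $ i m * (x $ j m * z $ k m + z $ j m * x $ k m) +
          z $ i m * (x $ j m * y $ k m + y $ j m * x $ k m)))"
    using polar_expand[OF assms] by blast
  show ?thesis unfolding ijk sum_distrib_left
    by (rule sum.cong) (auto simp: algebra_simps)
qed

lemma polar_diag:
  assumes "homogeneous 3 f"
  shows "polar f x x x = eval_poly f x"
proof -
  obtain i j k where ijk: "\<And>x :: 'a ^ 4. eval_poly f x =
       (\<Sum>m\<in>Poly_Mapping.keys f. of_real (Poly_Mapping.lookup f m) * (x $ i m * x $ j m * x $ k m))"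
    using eval_poly_cubic[OF assms] by blast
  have scale: "eval_poly f (c *s x) = c^3 * eval_poly f x" for c
    unfolding ijk sum_distrib_left by (rule sum.cong) (auto simp: power3_eq_cube)
  have "x + x = 2 *s x" "x + x + x = 3 *s x"
    by (simp_all add: vec_eq_iff)
  then show ?thesis
    unfolding polar_def by (simp add: scale)
qed

lemma polar_linear:
  assumes "homogeneous 3 f"
  shows "polar f (x + x') y z = polar f x y z + polar f x' y z"
    and "polar f x (y + y') z = polar f x y z + polar f x y' z"
    and "polar f x y (z + z') = polar f x y z + polar f x y z'"
    and "polar f (c *s x) y z = c * polar f x y z"
    and "polar f x (c *s y) z = c * polar f x y z"
    and "polar f x y (c *s z) = c * polar f x y z"
proof -
  note add = polar_add_right[OF assms] and scale = polar_scale_right[OF assms]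
  show "polar f x y (z + z') = polar f x y z + polar f x y z'"
    and "polar f x y (c *s z) = c * polar f x y z"
    by (rule add scale)+
  show mid: "polar f x (y + y') z = polar f x y z + polar f x y' z"
    and mids: "polar f x (c *s y) z = c * polar f x y z" for x y y' z c
    by (simp_all only: polar_commute(2)[of f x _ z] add scale)
  show "polar f (x + x') y z = polar f x y z + polar f x' y z"
    and "polar f (c *s x) y z = c * polar f x y z"
    by (simp_all only: polar_commute(1)[of f _ y z] mid mids)
qed

lemma polar_real_linear:
  fixes x y z :: "real^4"
  assumes "homogeneous 3 f"
  shows "polar f (c *\<^sub>R x) y z = c * polar f x y z"
    and "polar f x (c *\<^sub>R y) z = c * polar f x y z"
    and "polar f x y (c *\<^sub>R z) = c * polar f x y z"
  using polar_linear(4-6)[OF assms, where c = c] by (simp_all add: scalar_mult_eq_scaleR)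

lemma eval_poly_add:
  assumes "homogeneous 3 f"
  shows "eval_poly f (x + y) = eval_poly f x + 3 * polar f x x y + 3 * polar f x y y + eval_poly f y"
proof -
  have "eval_poly f (x + y) = polar f (x + y) (x + y) (x + y)"
    by (simp add: polar_diag[OF assms])
  also have "\<dots> = polar f x x x + 3 * polar f x x y + 3 * polar f x y y + polar f y y y"
    unfolding polar_linear[OF assms] by (simp add: polar_commute)
  finally show ?thesis by (simp add: polar_diag[OF assms])
qed

definition complexify :: "real^4 \<Rightarrow> complex^4" where
  "complexify x = (\<chi> i. complex_of_real (x $ i))"

definition conj_vec :: "complex^4 \<Rightarrow> complex^4" where
  "conj_vec z = (\<chi> i. cnj (z $ i))"

lemma eval_poly_complexify: "eval_poly f (complexify x) = of_real (eval_poly f x)"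
  by (simp add: eval_poly_def complexify_def)

lemma complexify_add: "complexify (x + y) = complexify x + complexify y"
  and complexify_scale: "complexify (c *\<^sub>R x) = of_real c *s complexify x"
  by (simp_all add: complexify_def vec_eq_iff)

lemma polar_complexify:
  "polar f (complexify x) (complexify y) (complexify z) = of_real (polar f x y z)"
  by (simp add: polar_def complexify_add[symmetric] eval_poly_complexify)

lemma eval_poly_conj: "eval_poly f (conj_vec z) = cnj (eval_poly f z)"
  by (simp add: eval_poly_def conj_vec_def)

lemma conj_vec_simps [simp]:
  "conj_vec (x + y) = conj_vec x + conj_vec y"
  "conj_vec (c *s x) = cnj c *s conj_vec x"
  "conj_vec (conj_vec x) = x"
  "conj_vec (complexify r) = complexify r"
  by (simp_all add: conj_vec_def complexify_def vec_eq_iff)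

lemma polar_conj: "polar f (conj_vec x) (conj_vec y) (conj_vec z) = cnj (polar f x y z)"
  by (simp add: polar_def eval_poly_conj flip: conj_vec_simps(1))

lemma eval_poly_differentiable:
  fixes g :: "'b::real_normed_vector \<Rightarrow> 'a::real_normed_field ^ 4"
  assumes "g differentiable (at w)"
  shows "(\<lambda>w. eval_poly f (g w)) differentiable (at w)"
proof -
  obtain g' where g': "(g has_derivative g') (at w)" using assms by (auto simp: differentiable_def)
  have comp: "(\<lambda>w. g w $ i) differentiable (at w)" for i
    using bounded_linear.has_derivative[OF bounded_linear_vec_nth g'] by (auto simp: differentiable_def)
  have mono: "(\<lambda>w. \<Prod>i\<in>I. g w $ i ^ e i) differentiable (at w)" for I and e :: "4 \<Rightarrow> nat"
    by (induction I rule: infinite_finite_induct) (auto intro!: derivative_intros comp)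
  show ?thesis unfolding eval_poly_def
    by (intro differentiable_sum ballI differentiable_mult differentiable_const mono) auto
qed

text \<open>
  The polynomial is differentiable, so its derivative can be read off from directional derivatives,
  which the binomial expansion by \<open>T\<close> supplies.
\<close>

lemma eval_poly_has_derivative:
  fixes x :: "real^4"
  assumes "homogeneous 3 f"
  shows "(eval_poly f has_derivative (\<lambda>h. 3 * polar f x x h)) (at x)"
proof -
  obtain D where D: "(eval_poly f has_derivative D) (at x)"
    using eval_poly_differentiable[of "\<lambda>x. x" x f] by (auto simp: differentiable_def)
  have "D h = 3 * polar f x x h" for h
  proof -
    have "((\<lambda>t. eval_poly f (x + t *\<^sub>R h)) has_derivative (\<lambda>t. D (t *\<^sub>R h))) (at 0)"
      by (rule has_derivative_compose[of "\<lambda>t. x + t *\<^sub>R h" _ _ UNIV "eval_poly f", simplified])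
        (auto intro!: derivative_eq_intros D)
    moreover have "((\<lambda>t. eval_poly f (x + t *\<^sub>R h)) has_derivative (\<lambda>t. t * (3 * polar f x x h))) (at 0)"
      unfolding eval_poly_add[OF assms] polar_real_linear[OF assms] polar_diag[OF assms, of "_ *\<^sub>R h", symmetric]
      by (auto intro!: derivative_eq_intros)
    ultimately have "(\<lambda>t. D (t *\<^sub>R h)) = (\<lambda>t. t * (3 * polar f x x h))"
      by (rule has_derivative_unique)
    from fun_cong[OF this, of 1] show ?thesis by simp
  qed
  then have "D = (\<lambda>h. 3 * polar f x x h)" by auto
  then show ?thesis using D by simp
qed

lemma eval_poly_partial_deriv:
  fixes z h :: "complex^4"
  assumes "homogeneous 3 f"
  shows "deriv (\<lambda>t. eval_poly f (z + t *s h)) 0 = 3 * polar f z z h"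
proof (rule DERIV_imp_deriv)
  have eq: "(\<lambda>t. eval_poly f (z + t *s h)) = (\<lambda>t. eval_poly f z + t * (3 * polar f z z h)
      + t^2 * (3 * polar f z h h) + t^3 * eval_poly f h)"
  proof
    fix t
    have "eval_poly f (t *s h) = t^3 * eval_poly f h"
      unfolding polar_diag[OF assms, symmetric] polar_linear[OF assms] by (simp add: power3_eq_cube)
    then show "eval_poly f (z + t *s h) = eval_poly f z + t * (3 * polar f z z h)
      + t^2 * (3 * polar f z h h) + t^3 * eval_poly f h"
      unfolding eval_poly_add[OF assms] polar_linear[OF assms] by (simp add: power2_eq_square)
  qed
  have "((\<lambda>t. A + t * B + t^2 * C + t^3 * E) has_field_derivative B) (at 0)" for A B C E :: complex
    by (auto intro!: derivative_eq_intros)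
  from this show "((\<lambda>t. eval_poly f (z + t *s h)) has_field_derivative 3 * polar f z z h) (at 0)"
    unfolding eq .
qed

section \<open>Segre's quadratic form of a line\<close>

text \<open>
  For a line \<open>p\<close> spanned by \<open>a\<close> and \<open>b\<close>, differentiation of \<open>f\<close> in direction \<open>\<nu>\<close> gives a binary
  quadratic form in the coordinates \<open>(u, v)\<close> of \<open>u a + v b\<close>, with coefficients
  \<open>3 T(a, a, \<nu>)\<close>, \<open>3 T(a, b, \<nu>)\<close>, \<open>3 T(b, b, \<nu>)\<close>. These are the values of \<open>L\<^sub>1\<^sub>1\<close>, \<open>L\<^sub>1\<^sub>2\<close>, \<open>L\<^sub>2\<^sub>2\<close> at \<open>\<nu>\<close>.
  Up to the factor 9 the definition below is therefore \<open>L\<^sub>1\<^sub>2\<^sup>2 - L\<^sub>1\<^sub>1 L\<^sub>2\<^sub>2\<close>, as a function on the whole of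
  \<open>\<real>\<^sup>4\<close> and without a choice of coordinates transversal to the line.
\<close>

definition segre :: "poly4 \<Rightarrow> real^4 \<Rightarrow> real^4 \<Rightarrow> real^4 \<Rightarrow> real" where
  "segre f a b \<nu> = (polar f a b \<nu>)\<^sup>2 - polar f a a \<nu> * polar f b b \<nu>"

definition segre_polar :: "poly4 \<Rightarrow> real^4 \<Rightarrow> real^4 \<Rightarrow> real^4 \<Rightarrow> real^4 \<Rightarrow> real" where
  "segre_polar f a b \<mu> \<nu> = polar f a b \<mu> * polar f a b \<nu>
     - (polar f a a \<mu> * polar f b b \<nu> + polar f a a \<nu> * polar f b b \<mu>) / 2"

text \<open>
  The determinant of the Gram matrix of Segre's form on the complement spanned by \<open>c\<close> and \<open>d\<close>.
  Up to a positive constant it is minus its discriminant. It is also, up to a constant, the resultant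
  of the two binary quadratic forms \<open>T(\<cdot>, \<cdot>, c)\<close> and \<open>T(\<cdot>, \<cdot>, d)\<close> on the line.
\<close>

definition segre_disc :: "poly4 \<Rightarrow> real^4 \<Rightarrow> real^4 \<Rightarrow> real^4 \<Rightarrow> real^4 \<Rightarrow> real" where
  "segre_disc f a b c d = segre f a b c * segre f a b d - (segre_polar f a b c d)\<^sup>2"

text \<open>
  A basis of \<open>\<real>\<^sup>4\<close> whose first two members span \<open>p\<close>. It carries the same information as the
  coordinate matrix of an adapted expansion, in the column order \<open>c, d, a, b\<close>.
\<close>

definition adapted_basis :: "(real^4) set \<Rightarrow> real^4 \<Rightarrow> real^4 \<Rightarrow> real^4 \<Rightarrow> real^4 \<Rightarrow> bool" where
  "adapted_basis p a b c d \<longleftrightarrow>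
     p = {u *\<^sub>R a + v *\<^sub>R b | u v. True} \<and>
     (\<forall>\<nu>. \<exists>x y u v. \<nu> = x *\<^sub>R c + y *\<^sub>R d + (u *\<^sub>R a + v *\<^sub>R b)) \<and>
     (\<forall>x y u v. x *\<^sub>R c + y *\<^sub>R d + (u *\<^sub>R a + v *\<^sub>R b) = 0 \<longrightarrow> x = 0 \<and> y = 0 \<and> u = 0 \<and> v = 0)"

lemma matrix_vector_mult_columns:
  "(A::real^4^4) *v vector [x, y, u, v]
     = x *\<^sub>R column 1 A + y *\<^sub>R column 2 A + (u *\<^sub>R column 3 A + v *\<^sub>R column 4 A)"
  by (simp add: vec_eq_iff matrix_vector_mult_def sum_4 column_def vector_def algebra_simps)

lemma vector_4_cases: "\<exists>x y u v. (w::real^4) = vector [x, y, u, v]"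
proof -
  have "w = vector [w $ 1, w $ 2, w $ 3, w $ 4]" by (simp add: vec_eq_iff forall_4 vector_def)
  then show ?thesis by blast
qed

lemma vector_4_eq_0: "(vector [x, y, u, v] :: real^4) = 0 \<longleftrightarrow> x = 0 \<and> y = 0 \<and> u = 0 \<and> v = 0"
  by (simp add: vec_eq_iff forall_4 vector_def)

lemma adapted_basis_columns:
  assumes "invertible (A::real^4^4)" and "p = {A *v vector [0, 0, u, v] | u v. True}"
  shows "adapted_basis p (column 3 A) (column 4 A) (column 1 A) (column 2 A)"
proof -
  obtain B where B: "A ** B = mat 1" "B ** A = mat 1" using assms(1) by (auto simp: invertible_def)
  have "\<exists>x y u v. \<nu> = A *v vector [x, y, u, v]" for \<nu>
  proof -
    have "\<nu> = A *v (B *v \<nu>)" by (simp add: matrix_vector_mul_assoc B)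
    then show ?thesis using vector_4_cases[of "B *v \<nu>"] by metis
  qed
  moreover have "x = 0 \<and> y = 0 \<and> u = 0 \<and> v = 0" if "A *v vector [x, y, u, v] = 0" for x y u v
  proof -
    have "vector [x, y, u, v] = B *v (A *v vector [x, y, u, v])"
      by (simp add: matrix_vector_mul_assoc B)
    then show ?thesis using that by (simp add: vector_4_eq_0)
  qed
  ultimately show ?thesis
    unfolding adapted_basis_def assms(2) matrix_vector_mult_columns by simp
qed

lemma adapted_basis_matrix:
  assumes "adapted_basis p a b c d"
  obtains A :: "real^4^4" where "invertible A" "p = {A *v vector [0, 0, u, v] | u v. True}"
    "column 1 A = c" "column 2 A = d" "column 3 A = a" "column 4 A = b"
proof -
  define A :: "real^4^4" where "A = transpose (vector [c, d, a, b])"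
  have col: "column 1 A = c" "column 2 A = d" "column 3 A = a" "column 4 A = b"
    by (simp_all add: A_def column_transpose row_def vector_def vec_eq_iff)
  have "inj ((*v) A)"
  proof (rule injI)
    fix v w assume "A *v v = A *v w"
    then have "A *v (v - w) = 0" by (simp add: matrix_vector_mult_diff_distrib)
    moreover obtain x y u s where vw: "v - w = vector [x, y, u, s]" using vector_4_cases by blast
    ultimately have "x *\<^sub>R c + y *\<^sub>R d + (u *\<^sub>R a + s *\<^sub>R b) = 0"
      unfolding vw matrix_vector_mult_columns col by simp
    then have "x = 0 \<and> y = 0 \<and> u = 0 \<and> s = 0" using assms unfolding adapted_basis_def by blast
    then have "v - w = 0" unfolding vw vector_4_eq_0 .
    then show "v = w" by simp
  qed
  then have "invertible A"
    using invertible_left_inverse matrix_left_invertible_injective by blast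
  moreover have "p = {A *v vector [0, 0, u, v] | u v. True}"
    using assms unfolding adapted_basis_def matrix_vector_mult_columns col by simp
  ultimately show ?thesis using that col by blast
qed

text \<open>
  A change of the basis of the line multiplies the discriminant of every binary quadratic form on it
  by the square of the determinant. The sign of Segre's form at \<open>\<nu>\<close> hence depends on the line only.
\<close>

lemma segre_change_of_basis:
  assumes f: "homogeneous 3 f"
  shows "segre f (\<alpha> *\<^sub>R a + \<beta> *\<^sub>R b) (\<gamma> *\<^sub>R a + \<delta> *\<^sub>R b) \<nu> = (\<alpha> * \<delta> - \<beta> * \<gamma>)\<^sup>2 * segre f a b \<nu>"
proof -
  have "polar f b a \<nu> = polar f a b \<nu>" by (rule polar_commute)
  then show ?thesis
    unfolding segre_def polar_linear[OF f] polar_real_linear[OF f]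
    by (simp add: algebra_simps power2_eq_square)
qed

lemma polar_vanishes_on_line:
  assumes "p \<in> real_lines f" "x \<in> p" "y \<in> p" "z \<in> p"
  shows "polar f x y z = 0"
  using assms by (simp add: polar_def real_lines_def subspace_add)

lemma adapted_basis_mem:
  assumes "adapted_basis p a b c d"
  shows "a \<in> p" "b \<in> p"
proof -
  have "a = 1 *\<^sub>R a + 0 *\<^sub>R b" "b = 0 *\<^sub>R a + 1 *\<^sub>R b" by simp_all
  then show "a \<in> p" "b \<in> p" using assms unfolding adapted_basis_def by blast+
qed

text \<open>
  All of \<open>T(p, p, p)\<close> vanishes, so Segre's form is insensitive to the component of its argument
  along the line: it lives on the normal space.
\<close>

lemma segre_expand:
  assumes f: "homogeneous 3 f" and p: "p \<in> real_lines f" "adapted_basis p a b c d"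
  shows "segre f a b (x *\<^sub>R c + y *\<^sub>R d + (u *\<^sub>R a + v *\<^sub>R b))
    = segre f a b c * x\<^sup>2 + 2 * segre_polar f a b c d * x * y + segre f a b d * y\<^sup>2"
proof -
  have "polar f s t a = 0" "polar f s t b = 0" if "s \<in> {a, b}" "t \<in> {a, b}" for s t
    using that adapted_basis_mem[OF p(2)] polar_vanishes_on_line[OF p(1)] by auto
  then show ?thesis
    unfolding segre_def segre_polar_def polar_linear[OF f] polar_real_linear[OF f]
    by (simp add: algebra_simps power2_eq_square)
qed

section \<open>Hyperbolic and elliptic lines through the discriminant\<close>

text \<open>
  Completing the square shows that \<open>A q\<close> is a square plus \<open>(A C - B\<^sup>2) y\<^sup>2\<close>. So \<open>q\<close> cannot change sign if the
  determinant is non-negative; if it is negative, the vector \<open>(B, -A)\<close>, at which the square vanishes,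
  has a value of the sign opposite to that at \<open>(1, 0)\<close>. For \<open>A = 0\<close> the roles of the coordinates
  are exchanged, and for \<open>A = C = 0\<close> the form is \<open>2 B x y\<close>.
\<close>

lemma indefinite_iff_disc:
  "indefinite (\<lambda>x y. A * x\<^sup>2 + 2 * B * x * y + C * y\<^sup>2) \<longleftrightarrow> A * C - B\<^sup>2 < 0"
  (is "indefinite ?q \<longleftrightarrow> _")
proof
  have sq: "A * ?q x y = (A * x + B * y)\<^sup>2 + (A * C - B\<^sup>2) * y\<^sup>2"
       "C * ?q x y = (B * x + C * y)\<^sup>2 + (A * C - B\<^sup>2) * x\<^sup>2" for x y
    by (simp_all add: power2_eq_square algebra_simps)
  assume "indefinite ?q"
  then obtain x y x' y' where pos: "?q x y > 0" and neg: "?q x' y' < 0"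
    unfolding indefinite_def by blast
  show "A * C - B\<^sup>2 < 0"
  proof (rule ccontr)
    assume "\<not> A * C - B\<^sup>2 < 0"
    then have nn: "A * ?q s t \<ge> 0" "C * ?q s t \<ge> 0" for s t unfolding sq by simp_all
    have "A = 0" "C = 0"
      using nn[of x y] nn[of x' y'] pos neg by (meson antisym mult_le_0_iff not_less zero_le_mult_iff)+
    then show False using \<open>\<not> A * C - B\<^sup>2 < 0\<close> pos by simp
  qed
next
  assume neg: "A * C - B\<^sup>2 < 0"
  have 1: "?q 1 0 = A" "?q 0 1 = C" "?q B (-A) = A * (A * C - B\<^sup>2)" "?q (-C) B = C * (A * C - B\<^sup>2)"
    "?q 1 1 = A + 2 * B + C" "?q 1 (-1) = A - 2 * B + C"
    by (simp_all add: power2_eq_square algebra_simps)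
  consider "A > 0" | "A < 0" | "C > 0" | "C < 0" | "A = 0" "C = 0" by linarith
  then show "indefinite ?q"
  proof cases
    case 1
    then have "?q 1 0 > 0" "?q B (-A) < 0" using neg 1 by (simp_all only: \<open>?q 1 0 = A\<close> \<open>?q B (-A) = A * (A * C - B\<^sup>2)\<close> mult_pos_neg)
    then show ?thesis unfolding indefinite_def by blast
  next
    case 2
    then have "?q 1 0 < 0" "?q B (-A) > 0" using neg by (simp_all only: \<open>?q 1 0 = A\<close> \<open>?q B (-A) = A * (A * C - B\<^sup>2)\<close> mult_neg_neg)
    then show ?thesis unfolding indefinite_def by blast
  next
    case 3
    then have "?q 0 1 > 0" "?q (-C) B < 0" using neg by (simp_all only: \<open>?q 0 1 = C\<close> \<open>?q (-C) B = C * (A * C - B\<^sup>2)\<close> mult_pos_neg)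
    then show ?thesis unfolding indefinite_def by blast
  next
    case 4
    then have "?q 0 1 < 0" "?q (-C) B > 0" using neg by (simp_all only: \<open>?q 0 1 = C\<close> \<open>?q (-C) B = C * (A * C - B\<^sup>2)\<close> mult_neg_neg)
    then show ?thesis unfolding indefinite_def by blast
  next
    case 5
    then have "B \<noteq> 0" using neg by auto
    then have "(?q 1 1 > 0 \<and> ?q 1 (-1) < 0) \<or> (?q 1 1 < 0 \<and> ?q 1 (-1) > 0)" using 5 by auto
    then show ?thesis unfolding indefinite_def by blast
  qed
qed

lemma definite_iff_disc:
  "definite (\<lambda>x y. A * x\<^sup>2 + 2 * B * x * y + C * y\<^sup>2) \<longleftrightarrow> A * C - B\<^sup>2 > 0"
  (is "definite ?q \<longleftrightarrow> _")
proof
  have sq: "A * ?q x y = (A * x + B * y)\<^sup>2 + (A * C - B\<^sup>2) * y\<^sup>2" for x y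
    by (simp add: power2_eq_square algebra_simps)
  {
    assume d: "definite ?q"
    \<comment> \<open>\<open>(B, -A)\<close> is orthogonal to \<open>(1, 0)\<close> for the form, so both values together give the sign of the
      determinant.\<close>
    have "?q 1 0 = A" "?q B (-A) = A * (A * C - B\<^sup>2)"
      by (simp_all add: power2_eq_square algebra_simps)
    moreover have "?q 1 0 * ?q B (-A) > 0" if "A \<noteq> 0"
      using d that unfolding definite_def by (metis mult_neg_neg mult_pos_pos neg_equal_0_iff_equal old.prod.inject zero_neq_one)
    moreover have "?q 1 0 \<noteq> 0" using d unfolding definite_def by (metis less_irrefl old.prod.inject zero_neq_one)
    ultimately have "A\<^sup>2 * (A * C - B\<^sup>2) > 0" by (simp add: power2_eq_square mult.assoc)
    then show "A * C - B\<^sup>2 > 0" by (simp add: zero_less_mult_iff)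
  }
  assume pos: "A * C - B\<^sup>2 > 0"
  then have "A \<noteq> 0" by auto
  have "A * ?q x y > 0" if "(x, y) \<noteq> (0, 0)" for x y
  proof (cases "y = 0")
    case True
    then show ?thesis using that \<open>A \<noteq> 0\<close> unfolding sq by simp
  next
    case False
    then show ?thesis using pos unfolding sq by (simp add: add_nonneg_pos)
  qed
  then show "definite ?q" unfolding definite_def by (cases "A > 0") (auto simp: zero_less_mult_iff)
qed

lemma segre_form_disc:
  assumes f: "homogeneous 3 f" and p: "p \<in> real_lines f" "adapted_basis p a b c d"
  shows "indefinite (\<lambda>x y. segre f a b (x *\<^sub>R c + y *\<^sub>R d)) \<longleftrightarrow> segre_disc f a b c d < 0"
    and "definite (\<lambda>x y. segre f a b (x *\<^sub>R c + y *\<^sub>R d)) \<longleftrightarrow> segre_disc f a b c d > 0"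
  using segre_expand[OF f p, where u = 0 and v = 0]
  by (simp_all add: indefinite_iff_disc definite_iff_disc segre_disc_def)

text \<open>
  Both the scaling under a change of basis of the line and the descent to the normal space leave the
  set of values unchanged up to positive factors. This is what makes the type of a line independent
  of the coordinates in which it is computed.
\<close>

lemma segre_type_invariant:
  assumes f: "homogeneous 3 f" and p: "p \<in> real_lines f"
    and B: "adapted_basis p a b c d" and B': "adapted_basis p a' b' c' d'"
  shows "indefinite (\<lambda>x y. segre f a b (x *\<^sub>R c + y *\<^sub>R d)) \<Longrightarrow>
         indefinite (\<lambda>x y. segre f a' b' (x *\<^sub>R c' + y *\<^sub>R d'))"
    and "definite (\<lambda>x y. segre f a b (x *\<^sub>R c + y *\<^sub>R d)) \<Longrightarrow>
         definite (\<lambda>x y. segre f a' b' (x *\<^sub>R c' + y *\<^sub>R d'))"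
proof -
  obtain \<alpha> \<beta> \<gamma> \<delta> where ab: "a = \<alpha> *\<^sub>R a' + \<beta> *\<^sub>R b'" "b = \<gamma> *\<^sub>R a' + \<delta> *\<^sub>R b'"
    using adapted_basis_mem[OF B] B' unfolding adapted_basis_def by blast
  define k where "k = (\<alpha> * \<delta> - \<beta> * \<gamma>)\<^sup>2"
  have k: "segre f a b \<nu> = k * segre f a' b' \<nu>" "k \<ge> 0" for \<nu>
    unfolding ab k_def by (simp_all add: segre_change_of_basis[OF f])
  have sg: "segre f a b \<nu> > 0 \<Longrightarrow> segre f a' b' \<nu> > 0" "segre f a b \<nu> < 0 \<Longrightarrow> segre f a' b' \<nu> < 0" for \<nu>
    using k(2) by (auto simp: k(1) zero_less_mult_iff mult_less_0_iff)
  {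
    assume "indefinite (\<lambda>x y. segre f a b (x *\<^sub>R c + y *\<^sub>R d))"
    then obtain \<nu> \<mu> where "segre f a' b' \<nu> > 0" "segre f a' b' \<mu> < 0"
      unfolding indefinite_def using sg by blast
    moreover have "\<exists>x y. segre f a' b' \<nu> = segre f a' b' (x *\<^sub>R c' + y *\<^sub>R d')" for \<nu>
    proof -
      obtain x y u v where "\<nu> = x *\<^sub>R c' + y *\<^sub>R d' + (u *\<^sub>R a' + v *\<^sub>R b')"
        using B' unfolding adapted_basis_def by blast
      then have "segre f a' b' \<nu> = segre f a' b' (x *\<^sub>R c' + y *\<^sub>R d')"
        using segre_expand[OF f p B', of x y u v] segre_expand[OF f p B', of x y 0 0] by simp
      then show ?thesis by blast
    qed
    ultimately show "indefinite (\<lambda>x y. segre f a' b' (x *\<^sub>R c' + y *\<^sub>R d'))"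
      unfolding indefinite_def by metis
  }
  {
    assume d: "definite (\<lambda>x y. segre f a b (x *\<^sub>R c + y *\<^sub>R d))"
    have *: "\<exists>x y. (x, y) \<noteq> (0, 0) \<and> segre f a b (x' *\<^sub>R c' + y' *\<^sub>R d') = segre f a b (x *\<^sub>R c + y *\<^sub>R d)"
      if "(x', y') \<noteq> (0, 0)" for x' y'
    proof -
      obtain x y u v where e: "x' *\<^sub>R c' + y' *\<^sub>R d' = x *\<^sub>R c + y *\<^sub>R d + (u *\<^sub>R a + v *\<^sub>R b)"
        using B unfolding adapted_basis_def by blast
      have "(x, y) \<noteq> (0, 0)"
      proof
        assume "(x, y) = (0, 0)"
        then have "x' *\<^sub>R c' + y' *\<^sub>R d' \<in> p" using e B unfolding adapted_basis_def by auto
        then obtain u' v' where "x' *\<^sub>R c' + y' *\<^sub>R d' = u' *\<^sub>R a' + v' *\<^sub>R b'"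
          using B' unfolding adapted_basis_def by blast
        then have "x' *\<^sub>R c' + y' *\<^sub>R d' + ((-u') *\<^sub>R a' + (-v') *\<^sub>R b') = 0" by simp
        then show False using that B' unfolding adapted_basis_def by blast
      qed
      moreover have "segre f a b (x' *\<^sub>R c' + y' *\<^sub>R d') = segre f a b (x *\<^sub>R c + y *\<^sub>R d)"
        unfolding e using segre_expand[OF f p B, of x y u v] segre_expand[OF f p B, of x y 0 0] by simp
      ultimately show ?thesis by blast
    qed
    from d show "definite (\<lambda>x y. segre f a' b' (x *\<^sub>R c' + y *\<^sub>R d'))"
      unfolding definite_def using * sg by metis
  }
qed

text \<open>
  Comparison of the coefficients of \<open>u\<^sup>2\<close>, \<open>u v\<close>, \<open>v\<^sup>2\<close> in the expansion of \<open>f(\<nu> + u a + v b)\<close> determines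
  the three linear forms.
\<close>

lemma adapted_expansion_segre:
  assumes f: "homogeneous 3 f" and p: "p \<in> real_lines f"
    and L: "adapted_expansion f p L11 L12 L22"
  shows "\<exists>a b c d. adapted_basis p a b c d \<and>
    (\<forall>x y. (L12 x y)\<^sup>2 - L11 x y * L22 x y = 9 * segre f a b (x *\<^sub>R c + y *\<^sub>R d))"
proof -
  obtain A :: "real^4^4" and Q1 Q2 C where A: "invertible A" "p = {A *v vector [0, 0, u, v] | u v. True}"
    and exp: "\<And>x y u v. eval_poly f (A *v vector [x, y, u, v]) =
        u^2 * L11 x y + 2 * u * v * L12 x y + v^2 * L22 x y + u * Q1 x y + v * Q2 x y + C x y"
    using L unfolding adapted_expansion_def by blast
  define a b c d where "a = column 3 A" "b = column 4 A" "c = column 1 A" "d = column 2 A"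
  note abcd = this
  have B: "adapted_basis p a b c d" using adapted_basis_columns[OF A] by (simp add: abcd)
  have "L11 x y = 3 * polar f a a (x *\<^sub>R c + y *\<^sub>R d) \<and>
        L12 x y = 3 * polar f a b (x *\<^sub>R c + y *\<^sub>R d) \<and>
        L22 x y = 3 * polar f b b (x *\<^sub>R c + y *\<^sub>R d)" for x y
  proof -
    define \<nu> where "\<nu> = x *\<^sub>R c + y *\<^sub>R d"
    have "u^2 * L11 x y + 2 * u * v * L12 x y + v^2 * L22 x y + u * Q1 x y + v * Q2 x y + C x y
      = eval_poly f \<nu> + 3 * (u * polar f \<nu> \<nu> a + v * polar f \<nu> \<nu> b)
       + 3 * (u\<^sup>2 * polar f a a \<nu> + 2 * u * v * polar f a b \<nu> + v\<^sup>2 * polar f b b \<nu>)" for u v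
    proof -
      have "u *\<^sub>R a + v *\<^sub>R b \<in> p" using B unfolding adapted_basis_def by blast
      then have van: "eval_poly f (u *\<^sub>R a + v *\<^sub>R b) = 0" using p by (simp add: real_lines_def)
      have "u^2 * L11 x y + 2 * u * v * L12 x y + v^2 * L22 x y + u * Q1 x y + v * Q2 x y + C x y
         = eval_poly f (\<nu> + (u *\<^sub>R a + v *\<^sub>R b))"
        unfolding exp[symmetric] matrix_vector_mult_columns \<nu>_def abcd by simp
      also have "\<dots> = eval_poly f \<nu> + 3 * polar f \<nu> \<nu> (u *\<^sub>R a + v *\<^sub>R b)
          + 3 * polar f (u *\<^sub>R a + v *\<^sub>R b) (u *\<^sub>R a + v *\<^sub>R b) \<nu>"
        unfolding eval_poly_add[OF f, of \<nu>] using van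
        by (simp add: polar_commute(1)[of f \<nu>] polar_commute(2)[of f _ \<nu> "_ + _"])
      finally show ?thesis
        unfolding polar_linear[OF f] polar_real_linear[OF f]
        by (simp add: polar_commute(1)[of f b a] algebra_simps power2_eq_square)
    qed
    note eq = this
    show ?thesis unfolding \<nu>_def[symmetric]
      using eq[of 0 0] eq[of 1 0] eq[of "-1" 0] eq[of 0 1] eq[of 0 "-1"] eq[of 1 1]
      by simp
  qed
  then have "(L12 x y)\<^sup>2 - L11 x y * L22 x y = 9 * segre f a b (x *\<^sub>R c + y *\<^sub>R d)" for x y
    by (simp add: segre_def algebra_simps power2_eq_square)
  then show ?thesis using B by blast
qed

lemma binary_form_1: "binary_form 1 (\<lambda>x y. A * x + B * y)"
  unfolding binary_form_def by (rule exI[of _ "\<lambda>i. if i = 0 then B else A"]) simp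

lemma binary_form_2: "binary_form 2 (\<lambda>x y. A * x\<^sup>2 + B * x * y + C * y\<^sup>2)"
  unfolding binary_form_def
  by (rule exI[of _ "\<lambda>i. if i = 0 then C else if i = 1 then B else A"])
    (simp add: numeral_2_eq_2 algebra_simps)

lemma binary_form_3: "binary_form 3 (\<lambda>x y. A * x^3 + B * x\<^sup>2 * y + C * x * y\<^sup>2 + D * y^3)"
  unfolding binary_form_def
  by (rule exI[of _ "\<lambda>i. if i = 0 then D else if i = 1 then C else if i = 2 then B else A"])
    (simp add: numeral_3_eq_3 numeral_2_eq_2 algebra_simps)

lemma adapted_expansion_exists:
  assumes f: "homogeneous 3 f" and p: "p \<in> real_lines f" and B: "adapted_basis p a b c d"
  shows "adapted_expansion f p
    (\<lambda>x y. 3 * polar f a a (x *\<^sub>R c + y *\<^sub>R d))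
    (\<lambda>x y. 3 * polar f a b (x *\<^sub>R c + y *\<^sub>R d))
    (\<lambda>x y. 3 * polar f b b (x *\<^sub>R c + y *\<^sub>R d))"
proof -
  obtain A :: "real^4^4" where A: "invertible A" "p = {A *v vector [0, 0, u, v] | u v. True}"
    "column 1 A = c" "column 2 A = d" "column 3 A = a" "column 4 A = b"
    using adapted_basis_matrix[OF B] by blast
  have lin: "binary_form 1 (\<lambda>x y. 3 * polar f s t (x *\<^sub>R c + y *\<^sub>R d))" for s t
    using binary_form_1[of "3 * polar f s t c" "3 * polar f s t d"]
    by (simp add: polar_linear[OF f] polar_real_linear[OF f] algebra_simps)
  have quad: "binary_form 2 (\<lambda>x y. 3 * polar f (x *\<^sub>R c + y *\<^sub>R d) (x *\<^sub>R c + y *\<^sub>R d) s)" for s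
    using binary_form_2[of "3 * polar f c c s" "6 * polar f c d s" "3 * polar f d d s"]
    by (simp add: polar_linear[OF f] polar_real_linear[OF f] polar_commute(1)[of f d c] algebra_simps power2_eq_square)
  have cub: "binary_form 3 (\<lambda>x y. eval_poly f (x *\<^sub>R c + y *\<^sub>R d))"
  proof -
    have "polar f d c c = polar f c c d" "polar f c d c = polar f c c d"
      "polar f d d c = polar f c d d" "polar f d c d = polar f c d d"
      by (metis polar_commute)+
    then show ?thesis
      unfolding polar_diag[OF f, symmetric]
      using binary_form_3[of "polar f c c c" "3 * polar f c c d" "3 * polar f c d d" "polar f d d d"]
      by (simp add: polar_linear[OF f] polar_real_linear[OF f] algebra_simps power2_eq_square power3_eq_cube)
  qed
  have exp: "eval_poly f (A *v vector [x, y, u, v]) =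
      u\<^sup>2 * (3 * polar f a a (x *\<^sub>R c + y *\<^sub>R d)) + 2 * u * v * (3 * polar f a b (x *\<^sub>R c + y *\<^sub>R d))
      + v\<^sup>2 * (3 * polar f b b (x *\<^sub>R c + y *\<^sub>R d))
      + u * (3 * polar f (x *\<^sub>R c + y *\<^sub>R d) (x *\<^sub>R c + y *\<^sub>R d) a)
      + v * (3 * polar f (x *\<^sub>R c + y *\<^sub>R d) (x *\<^sub>R c + y *\<^sub>R d) b)
      + eval_poly f (x *\<^sub>R c + y *\<^sub>R d)" for x y u v
  proof -
    define \<nu> where "\<nu> = x *\<^sub>R c + y *\<^sub>R d"
    have "u *\<^sub>R a + v *\<^sub>R b \<in> p" using B unfolding adapted_basis_def by blast
      then have van: "eval_poly f (u *\<^sub>R a + v *\<^sub>R b) = 0" using p by (simp add: real_lines_def)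
    have "eval_poly f (A *v vector [x, y, u, v]) = eval_poly f (\<nu> + (u *\<^sub>R a + v *\<^sub>R b))"
      unfolding matrix_vector_mult_columns A \<nu>_def by simp
    also have "\<dots> = eval_poly f \<nu> + 3 * polar f \<nu> \<nu> (u *\<^sub>R a + v *\<^sub>R b)
          + 3 * polar f (u *\<^sub>R a + v *\<^sub>R b) (u *\<^sub>R a + v *\<^sub>R b) \<nu>"
      unfolding eval_poly_add[OF f, of \<nu>] using van
      by (simp add: polar_commute(1)[of f \<nu>] polar_commute(2)[of f _ \<nu> "_ + _"])
    finally show ?thesis
      unfolding \<nu>_def[symmetric] polar_linear[OF f] polar_real_linear[OF f]
      by (simp add: polar_commute(1)[of f b a] algebra_simps power2_eq_square)
  qed
  show ?thesis
    unfolding adapted_expansion_def using A(1,2) lin quad cub exp by blast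
qed

lemma definite_scale: "k > 0 \<Longrightarrow> definite (\<lambda>x y. k * q x y) \<longleftrightarrow> definite q"
  and indefinite_scale: "k > 0 \<Longrightarrow> indefinite (\<lambda>x y. k * q x y) \<longleftrightarrow> indefinite q"
  for k :: real
  by (simp_all add: definite_def indefinite_def zero_less_mult_iff mult_less_0_iff)

text \<open>
  Any adapted basis may be used to test the type, because the type is an invariant of the line; the
  bases that appear below are orthonormal and come from complex points of the quadric.
\<close>

lemma line_type_iff_segre_disc:
  assumes f: "homogeneous 3 f" and p: "p \<in> real_lines f" and B: "adapted_basis p a b c d"
  shows "hyperbolic f p \<longleftrightarrow> segre_disc f a b c d < 0"
    and "elliptic f p \<longleftrightarrow> segre_disc f a b c d > 0"
proof -
  let ?q = "\<lambda>x y. segre f a b (x *\<^sub>R c + y *\<^sub>R d)"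
  note E = adapted_expansion_exists[OF f p B]
  have q9: "(3 * polar f a b \<nu>)\<^sup>2 - 3 * polar f a a \<nu> * (3 * polar f b b \<nu>) = 9 * segre f a b \<nu>" for \<nu>
    by (simp add: segre_def algebra_simps power2_eq_square)
  have "hyperbolic f p \<longleftrightarrow> indefinite ?q"
  proof
    assume "hyperbolic f p"
    then obtain L11 L12 L22 where L: "adapted_expansion f p L11 L12 L22"
      "indefinite (\<lambda>x y. (L12 x y)\<^sup>2 - L11 x y * L22 x y)" unfolding hyperbolic_def by blast
    then show "indefinite ?q"
      using adapted_expansion_segre[OF f p L(1)] segre_type_invariant(1)[OF f p _ B]
      by (auto simp: indefinite_scale)
  next
    assume "indefinite ?q"
    then show "hyperbolic f p" unfolding hyperbolic_def
      using E q9 by (intro exI conjI) (assumption, simp add: indefinite_scale)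
  qed
  then show "hyperbolic f p \<longleftrightarrow> segre_disc f a b c d < 0" using segre_form_disc[OF f p B] by simp
  have "elliptic f p \<longleftrightarrow> definite ?q"
  proof
    assume "elliptic f p"
    then obtain L11 L12 L22 where L: "adapted_expansion f p L11 L12 L22"
      "definite (\<lambda>x y. (L12 x y)\<^sup>2 - L11 x y * L22 x y)" unfolding elliptic_def by blast
    then show "definite ?q"
      using adapted_expansion_segre[OF f p L(1)] segre_type_invariant(2)[OF f p _ B]
      by (auto simp: definite_scale)
  next
    assume "definite ?q"
    then show "elliptic f p" unfolding elliptic_def
      using E q9 by (intro exI conjI) (assumption, simp add: definite_scale)
  qed
  then show "elliptic f p \<longleftrightarrow> segre_disc f a b c d > 0" using segre_form_disc[OF f p B] by simp
qed

section \<open>Non-singularity and the resultant\<close>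

text \<open>
  The hypotheses say that the first quadratic form has a double root (or vanishes) and that the second
  form is apolar to it. Apolarity to the square of a linear form means vanishing at the root of this
  form. Only if the first form vanishes identically is a complex root of the second one needed.
\<close>

lemma common_root_degenerate:
  fixes a b c a' b' c' :: real
  assumes "b\<^sup>2 = a * c" "a * c' + a' * c = 2 * b * b'"
  shows "\<exists>(u::complex) (v::complex). (u, v) \<noteq> (0, 0) \<and> a * u\<^sup>2 + 2 * b * u * v + c * v\<^sup>2 = 0
    \<and> a' * u\<^sup>2 + 2 * b' * u * v + c' * v\<^sup>2 = 0"
proof -
  consider "a \<noteq> 0" | "a = 0" "c \<noteq> 0" | "a = 0" "c = 0" by blast
  then show ?thesis
  proof cases
    case 1
    have "a * b\<^sup>2 - 2 * b\<^sup>2 * a + c * a\<^sup>2 = 0" using assms(1) by (simp add: algebra_simps power2_eq_square)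
    moreover have "a' * b\<^sup>2 - 2 * b' * b * a + c' * a\<^sup>2 = a * (a * c' + a' * c - 2 * b * b')"
      unfolding assms(1) by (simp add: algebra_simps power2_eq_square)
    then have "a' * b\<^sup>2 - 2 * b' * b * a + c' * a\<^sup>2 = 0" using assms(2) by simp
    ultimately have "complex_of_real (a * b\<^sup>2 - 2 * b\<^sup>2 * a + c * a\<^sup>2) = 0"
      "complex_of_real (a' * b\<^sup>2 - 2 * b' * b * a + c' * a\<^sup>2) = 0" by simp_all
    then show ?thesis using 1
      by (intro exI[of _ "- of_real b"] exI[of _ "of_real a"]) (simp add: algebra_simps power2_eq_square)
  next
    case 2
    then show ?thesis using assms by (intro exI[of _ 1] exI[of _ 0]) auto
  next
    case 3
    then have "b = 0" using assms by simp
    show ?thesis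
    proof (cases "a' = 0")
      case True
      then show ?thesis using 3 \<open>b = 0\<close> by (intro exI[of _ 1] exI[of _ 0]) auto
    next
      case False
      define s where "s = csqrt (of_real (b'\<^sup>2 - a' * c'))"
      have s: "s\<^sup>2 = of_real (b'\<^sup>2 - a' * c')" unfolding s_def by simp
      have "a' * (s - b')\<^sup>2 + 2 * b' * (s - b') * a' + c' * (complex_of_real a')\<^sup>2 = a' * (s\<^sup>2 - b'\<^sup>2 + a' * c')"
        by (simp add: algebra_simps power2_eq_square)
      also have "\<dots> = 0" unfolding s by simp
      finally show ?thesis using 3 \<open>b = 0\<close> False
        by (intro exI[of _ "s - b'"] exI[of _ "of_real a'"]) simp
    qed
  qed
qed

text \<open>
  If the discriminant form of the pencil spanned by two quadratic forms is degenerate, a member of its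
  radical is a perfect square (or zero) apolar to the whole pencil, and the preceding lemma gives a
  common root.
\<close>

lemma common_root:
  fixes P1 Q1 R1 P2 Q2 R2 :: real
  assumes "(Q1\<^sup>2 - P1 * R1) * (Q2\<^sup>2 - P2 * R2) = (Q1 * Q2 - (P1 * R2 + P2 * R1) / 2)\<^sup>2"
  shows "\<exists>(u::complex) (v::complex). (u, v) \<noteq> (0, 0) \<and> P1 * u\<^sup>2 + 2 * Q1 * u * v + R1 * v\<^sup>2 = 0
    \<and> P2 * u\<^sup>2 + 2 * Q2 * u * v + R2 * v\<^sup>2 = 0"
proof -
  define A B C where "A = Q1\<^sup>2 - P1 * R1" "B = Q1 * Q2 - (P1 * R2 + P2 * R1) / 2" "C = Q2\<^sup>2 - P2 * R2"
  note ABC = this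
  have "A * C = B\<^sup>2" using assms by (simp add: ABC)
  have "\<exists>x y. (x, y) \<noteq> (0, 0) \<and> A * x + B * y = 0 \<and> B * x + C * y = 0"
  proof (cases "A = 0 \<and> B = 0")
    case True
    then show ?thesis by (intro exI[of _ 1] exI[of _ 0]) auto
  next
    case False
    then show ?thesis using \<open>A * C = B\<^sup>2\<close>
      by (intro exI[of _ "-B"] exI[of _ A]) (auto simp: algebra_simps power2_eq_square)
  qed
  \<comment> \<open>A vector \<open>(x, y)\<close> of the radical; the corresponding member of the pencil is \<open>P u\<^sup>2 + 2 Q u v + R v\<^sup>2\<close>.\<close>
  then obtain x y where xy: "(x, y) \<noteq> (0, 0)" "A * x + B * y = 0" "B * x + C * y = 0" by blast
  define P Q R where "P = x * P1 + y * P2" "Q = x * Q1 + y * Q2" "R = x * R1 + y * R2"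
  note PQR = this
  have "Q\<^sup>2 - P * R = x * (A * x + B * y) + y * (B * x + C * y)"
    by (simp add: PQR ABC algebra_simps power2_eq_square)
  then have d: "Q\<^sup>2 = P * R" using xy by simp
  have "2 * Q * Q1 - (P * R1 + P1 * R) = 2 * (A * x + B * y)"
       "2 * Q * Q2 - (P * R2 + P2 * R) = 2 * (B * x + C * y)"
    by (simp_all add: PQR ABC field_simps power2_eq_square)
  then have p: "P * R1 + P1 * R = 2 * Q * Q1" "P * R2 + P2 * R = 2 * Q * Q2" using xy by simp_all
  have comb: "P * u\<^sup>2 + 2 * Q * u * v + R * v\<^sup>2 = x * (P1 * u\<^sup>2 + 2 * Q1 * u * v + R1 * v\<^sup>2)
     + y * (P2 * u\<^sup>2 + 2 * Q2 * u * v + R2 * v\<^sup>2)" for u v :: complex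
    by (simp add: PQR algebra_simps)
  show ?thesis
  proof (cases "x = 0")
    case True
    then have "y \<noteq> 0" using xy by simp
    from common_root_degenerate[OF d p(1)] obtain u v :: complex where
      "(u, v) \<noteq> (0, 0)" "P * u\<^sup>2 + 2 * Q * u * v + R * v\<^sup>2 = 0" "P1 * u\<^sup>2 + 2 * Q1 * u * v + R1 * v\<^sup>2 = 0" by blast
    then show ?thesis using comb[of u v] \<open>y \<noteq> 0\<close> by auto
  next
    case False
    from common_root_degenerate[OF d p(2)] obtain u v :: complex where
      "(u, v) \<noteq> (0, 0)" "P * u\<^sup>2 + 2 * Q * u * v + R * v\<^sup>2 = 0" "P2 * u\<^sup>2 + 2 * Q2 * u * v + R2 * v\<^sup>2 = 0" by blast
    then show ?thesis using comb[of u v] False by auto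
  qed
qed

lemma complexify_independent:
  assumes ab: "\<And>u v. u *\<^sub>R a + v *\<^sub>R b = 0 \<Longrightarrow> u = 0 \<and> v = 0"
    and z: "u *s complexify a + v *s complexify b = 0"
  shows "u = 0" "v = 0"
proof -
  have c: "u * of_real (a $ i) + v * of_real (b $ i) = 0" for i
    using arg_cong[OF z, of "\<lambda>z. z $ i"] by (simp add: complexify_def)
  have "Re u *\<^sub>R a + Re v *\<^sub>R b = 0"
    using arg_cong[OF c, of Re] by (subst vec_eq_iff) simp
  moreover have "Im u *\<^sub>R a + Im v *\<^sub>R b = 0"
    using arg_cong[OF c, of Im] by (subst vec_eq_iff) simp
  ultimately have "Re u = 0 \<and> Re v = 0" "Im u = 0 \<and> Im v = 0" using ab by blast+
  then show "u = 0" "v = 0" by (simp_all add: complex_eq_iff)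
qed
text \<open>
  A common complex root \<open>(u, v)\<close> of the quadratic forms \<open>T(\<cdot>, \<cdot>, c)\<close> and \<open>T(\<cdot>, \<cdot>, d)\<close> is a singular
  point \<open>z = u a + v b\<close> of the complex surface: the derivatives \<open>3 T(z, z, \<cdot>)\<close> vanish in the
  directions \<open>c\<close> and \<open>d\<close> by choice, and along the line because the line lies on the surface.
\<close>

lemma segre_disc_neq_0:
  assumes f: "homogeneous 3 f" and ns: "nonsingular f"
    and p: "p \<in> real_lines f" and B: "adapted_basis p a b c d"
  shows "segre_disc f a b c d \<noteq> 0"
proof
  assume "segre_disc f a b c d = 0"
  then obtain u v :: complex where uv: "(u, v) \<noteq> (0, 0)"
    "polar f a a c * u\<^sup>2 + 2 * polar f a b c * u * v + polar f b b c * v\<^sup>2 = 0"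
    "polar f a a d * u\<^sup>2 + 2 * polar f a b d * u * v + polar f b b d * v\<^sup>2 = 0"
    using common_root[of "polar f a b c" "polar f a a c" "polar f b b c"
        "polar f a b d" "polar f a a d" "polar f b b d"]
    by (auto simp: segre_disc_def segre_def segre_polar_def)
  define z where "z = u *s complexify a + v *s complexify b"
  have zz: "polar f z z (complexify \<nu>)
      = polar f a a \<nu> * u\<^sup>2 + 2 * polar f a b \<nu> * u * v + polar f b b \<nu> * v\<^sup>2" for \<nu>
    unfolding z_def polar_linear[OF f] polar_complexify polar_commute(1)[of f b a]
    by (simp add: algebra_simps power2_eq_square)
  have van: "polar f s t a = 0" "polar f s t b = 0" if "s \<in> {a, b}" "t \<in> {a, b}" for s t
    using that adapted_basis_mem[OF B] polar_vanishes_on_line[OF p] by auto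
  have zab: "polar f z z (complexify a) = 0" "polar f z z (complexify b) = 0"
    by (simp_all add: zz van)
  have zcd: "polar f z z (complexify c) = 0" "polar f z z (complexify d) = 0"
    using uv by (simp_all add: zz)
  have all: "polar f z z (complexify \<nu>) = 0" for \<nu>
  proof -
    obtain x y s t where "\<nu> = x *\<^sub>R c + y *\<^sub>R d + (s *\<^sub>R a + t *\<^sub>R b)"
      using B unfolding adapted_basis_def by blast
    then show ?thesis
      by (simp add: complexify_add complexify_scale polar_linear[OF f] zab zcd)
  qed
  have "deriv (\<lambda>t. eval_poly f (z + axis i t)) 0 = 0" for i
  proof -
    have "axis i t = t *s complexify (axis i 1)" for t :: complex
      by (simp add: vec_eq_iff axis_def complexify_def)
    then show ?thesis by (simp only: eval_poly_partial_deriv[OF f] all mult_zero_right)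
  qed
  moreover have "polar f z z (u *s complexify a + v *s complexify b) = 0"
    by (simp only: polar_linear(3,6)[OF f] zab mult_zero_right add_0_left)
  then have "eval_poly f z = 0"
    unfolding z_def[symmetric] polar_diag[OF f] .
  moreover have "z \<noteq> 0"
  proof
    assume "z = 0"
    have ind: "s = 0 \<and> t = 0" if "s *\<^sub>R a + t *\<^sub>R b = 0" for s t
    proof -
      have "0 *\<^sub>R c + 0 *\<^sub>R d + (s *\<^sub>R a + t *\<^sub>R b) = 0" using that by simp
      then show ?thesis using B unfolding adapted_basis_def by blast
    qed
    have "u = 0" "v = 0"
      using complexify_independent[OF ind] \<open>z = 0\<close> unfolding z_def by blast+
    then show False using uv(1) by blast
  qed
  ultimately show False using ns unfolding nonsingular_def by blast
qed

section \<open>Finiteness of the set of real lines\<close>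

lemma polar_has_derivative:
  fixes x y z :: "'b::real_normed_vector \<Rightarrow> real^4"
  assumes f: "homogeneous 3 f"
    and x: "(x has_derivative x') (at w)" and y: "(y has_derivative y') (at w)" and z: "(z has_derivative z') (at w)"
  shows "((\<lambda>w. polar f (x w) (y w) (z w)) has_derivative
    (\<lambda>h. polar f (x' h) (y w) (z w) + polar f (x w) (y' h) (z w) + polar f (x w) (y w) (z' h))) (at w)"
proof -
  have chain: "((\<lambda>w. eval_poly f (s w)) has_derivative (\<lambda>h. 3 * polar f (s w) (s w) (s' h))) (at w)"
    if "(s has_derivative s') (at w)" for s s' :: "'b \<Rightarrow> real^4"
    using has_derivative_compose[OF that eval_poly_has_derivative[OF f, of "s w"]] .
  have "((\<lambda>w. 1 / 6 * (eval_poly f (x w + y w + z w) - eval_poly f (x w + y w) - eval_poly f (x w + z w)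
      - eval_poly f (y w + z w) + eval_poly f (x w) + eval_poly f (y w) + eval_poly f (z w))) has_derivative
    (\<lambda>h. 1 / 6 * (3 * polar f (x w + y w + z w) (x w + y w + z w) (x' h + y' h + z' h)
       - 3 * polar f (x w + y w) (x w + y w) (x' h + y' h)
       - 3 * polar f (x w + z w) (x w + z w) (x' h + z' h)
       - 3 * polar f (y w + z w) (y w + z w) (y' h + z' h)
       + 3 * polar f (x w) (x w) (x' h) + 3 * polar f (y w) (y w) (y' h) + 3 * polar f (z w) (z w) (z' h)))) (at w)"
    by (intro has_derivative_mult_right has_derivative_add has_derivative_diff chain x y z)
  moreover have "1 / 6 * (3 * polar f (x w + y w + z w) (x w + y w + z w) (x' h + y' h + z' h)
       - 3 * polar f (x w + y w) (x w + y w) (x' h + y' h)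
       - 3 * polar f (x w + z w) (x w + z w) (x' h + z' h)
       - 3 * polar f (y w + z w) (y w + z w) (y' h + z' h)
       + 3 * polar f (x w) (x w) (x' h) + 3 * polar f (y w) (y w) (y' h) + 3 * polar f (z w) (z w) (z' h))
     = polar f (x' h) (y w) (z w) + polar f (x w) (y' h) (z w) + polar f (x w) (y w) (z' h)" for h
    unfolding polar_linear[OF f] by (simp add: polar_commute)
  ultimately have "((\<lambda>w. 1 / 6 * (eval_poly f (x w + y w + z w) - eval_poly f (x w + y w) - eval_poly f (x w + z w)
      - eval_poly f (y w + z w) + eval_poly f (x w) + eval_poly f (y w) + eval_poly f (z w))) has_derivative
    (\<lambda>h. polar f (x' h) (y w) (z w) + polar f (x w) (y' h) (z w) + polar f (x w) (y w) (z' h))) (at w)"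
    by (simp only:)
  then show ?thesis unfolding polar_def[of f "x _" "y _" "z _"] by simp
qed

definition orthonormal4 :: "real^4 \<Rightarrow> real^4 \<Rightarrow> real^4 \<Rightarrow> real^4 \<Rightarrow> bool" where
  "orthonormal4 a b c d \<longleftrightarrow> a \<bullet> a = 1 \<and> b \<bullet> b = 1 \<and> c \<bullet> c = 1 \<and> d \<bullet> d = 1 \<and>
     a \<bullet> b = 0 \<and> a \<bullet> c = 0 \<and> a \<bullet> d = 0 \<and> b \<bullet> c = 0 \<and> b \<bullet> d = 0 \<and> c \<bullet> d = 0"

text \<open>
  The columns of an orthogonal matrix are orthonormal as well as its rows. In this coordinate form
  the relation expands complex vectors just as real ones.
\<close>

lemma orthonormal4_completeness:
  assumes "orthonormal4 a b c d"
  shows "a $ i * a $ j + b $ i * b $ j + c $ i * c $ j + d $ i * d $ j = (if i = j then 1 else 0)"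
proof -
  define P :: "real^4^4" where "P = vector [a, b, c, d]"
  have row: "P $ 1 = a" "P $ 2 = b" "P $ 3 = c" "P $ 4 = d" by (simp_all add: P_def vector_def)
  have "P ** transpose P = mat 1"
  proof -
    have "(P ** transpose P) $ i $ j = P $ i \<bullet> P $ j" for i j
      by (simp add: matrix_matrix_mult_def transpose_def inner_vec_def)
    moreover have "P $ i \<bullet> P $ j = mat 1 $ i $ j" for i j
      using assms exhaust_4[of i] exhaust_4[of j]
      by (auto simp: row orthonormal4_def mat_def inner_commute)
    ultimately show ?thesis by (simp add: vec_eq_iff)
  qed
  then have "(transpose P ** P) $ i $ j = mat 1 $ i $ j" using matrix_left_right_inverse by metis
  then show ?thesis
    by (simp add: matrix_matrix_mult_def transpose_def sum_4 row mat_def)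
qed

lemma orthonormal4_expand:
  assumes "orthonormal4 a b c d"
  shows "\<nu> = (\<nu> \<bullet> c) *\<^sub>R c + (\<nu> \<bullet> d) *\<^sub>R d + ((\<nu> \<bullet> a) *\<^sub>R a + (\<nu> \<bullet> b) *\<^sub>R b)"
proof -
  have "((\<nu> \<bullet> c) *\<^sub>R c + (\<nu> \<bullet> d) *\<^sub>R d + ((\<nu> \<bullet> a) *\<^sub>R a + (\<nu> \<bullet> b) *\<^sub>R b)) $ i = \<nu> $ i" for i
  proof -
    have "((\<nu> \<bullet> c) *\<^sub>R c + (\<nu> \<bullet> d) *\<^sub>R d + ((\<nu> \<bullet> a) *\<^sub>R a + (\<nu> \<bullet> b) *\<^sub>R b)) $ i
       = (\<Sum>j\<in>UNIV. \<nu> $ j * (a $ i * a $ j + b $ i * b $ j + c $ i * c $ j + d $ i * d $ j))"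
      by (simp add: inner_vec_def sum_distrib_right sum_distrib_left sum.distrib[symmetric] algebra_simps)
    also have "\<dots> = \<nu> $ i"
      unfolding orthonormal4_completeness[OF assms] by (simp add: if_distrib cong: if_cong)
    finally show ?thesis .
  qed
  then show ?thesis by (simp add: vec_eq_iff)
qed

lemma orthonormal4_adapted_basis:
  assumes o: "orthonormal4 a b c d"
  shows "adapted_basis {u *\<^sub>R a + v *\<^sub>R b | u v. True} a b c d"
  unfolding adapted_basis_def
proof (intro conjI allI impI refl)
  show "\<exists>x y u v. \<nu> = x *\<^sub>R c + y *\<^sub>R d + (u *\<^sub>R a + v *\<^sub>R b)" for \<nu>
    using orthonormal4_expand[OF o] by blast
next
  fix x y u v
  let ?w = "x *\<^sub>R c + y *\<^sub>R d + (u *\<^sub>R a + v *\<^sub>R b)"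
  assume "?w = 0"
  then have "?w \<bullet> c = 0" "?w \<bullet> d = 0" "?w \<bullet> a = 0" "?w \<bullet> b = 0" by simp_all
  then show "x = 0" "y = 0" "u = 0" "v = 0"
    using o by (auto simp: orthonormal4_def inner_add_left inner_add_right inner_commute)
qed

lemma orthonormal_pair:
  assumes "subspace (p :: (real^4) set)" "dim p = 2"
  obtains a b where "a \<bullet> a = 1" "b \<bullet> b = 1" "a \<bullet> b = 0" "p = {u *\<^sub>R a + v *\<^sub>R b | u v. True}"
proof -
  obtain B where B: "B \<subseteq> p" "pairwise orthogonal B" "\<And>x. x \<in> B \<Longrightarrow> norm x = 1" "card B = 2" "span B = p"
    using orthonormal_basis_subspace[OF assms(1)] assms(2) by metis
  then obtain a b where ab: "B = {a, b}" "a \<noteq> b" by (meson card_2_iff)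
  have "p = {u *\<^sub>R a + v *\<^sub>R b | u v. True}"
    unfolding B(5)[symmetric] ab(1) span_insert span_empty
    by (auto simp: algebra_simps)
  moreover have "a \<bullet> a = 1" "b \<bullet> b = 1" using B(3) ab by (simp_all add: norm_eq_1)
  moreover have "a \<bullet> b = 0" using B(2) ab by (auto simp: pairwise_def orthogonal_def)
  ultimately show ?thesis using that by blast
qed

lemma orthonormal4_extend:
  assumes ab: "a \<bullet> a = 1" "b \<bullet> b = 1" "a \<bullet> b = 0"
  obtains c d where "orthonormal4 a b c d"
proof -
  have "dim {a, b} = 2"
  proof -
    have "a \<noteq> b" using ab by auto
    moreover have "independent {a, b}"
      by (rule pairwise_orthogonal_independent)
        (use ab in \<open>auto simp: pairwise_def orthogonal_def inner_commute\<close>)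
    ultimately show ?thesis by (simp add: dim_eq_card_independent)
  qed
  then have "dim (span {a, b}) = 2" by simp
  moreover have "dim {y \<in> UNIV. \<forall>x\<in>span {a, b}. orthogonal x y} + dim (span {a, b}) = dim (UNIV :: (real^4) set)"
    by (rule dim_subspace_orthogonal_to_vectors) auto
  ultimately have dim: "dim {y. \<forall>x\<in>span {a, b}. orthogonal x y} = 2" by (simp add: dim_UNIV)
  have sub: "subspace {y. \<forall>x\<in>span {a, b}. orthogonal x y}"
    by (auto simp: subspace_def orthogonal_clauses)
  obtain c d where cd: "c \<bullet> c = 1" "d \<bullet> d = 1" "c \<bullet> d = 0"
    and sp: "{y. \<forall>x\<in>span {a, b}. orthogonal x y} = {u *\<^sub>R c + v *\<^sub>R d | u v. True}"
    using orthonormal_pair[OF sub dim] by blast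
  have "c = 1 *\<^sub>R c + 0 *\<^sub>R d" "d = 0 *\<^sub>R c + 1 *\<^sub>R d" by simp_all
  then have "c \<in> {y. \<forall>x\<in>span {a, b}. orthogonal x y}" "d \<in> {y. \<forall>x\<in>span {a, b}. orthogonal x y}"
    unfolding sp by blast+
  moreover have "a \<in> span {a, b}" "b \<in> span {a, b}" by (auto intro: span_base)
  ultimately have "orthonormal4 a b c d" using ab cd by (auto simp: orthonormal4_def orthogonal_def)
  then show ?thesis using that by blast
qed

text \<open>
  An injective derivative is bounded below, and near the point this bound beats the error of the linear
  approximation.
\<close>

lemma isolated_zero:
  fixes F :: "'a::euclidean_space \<Rightarrow> 'b::euclidean_space"
  assumes F: "(F has_derivative D) (at x)" and inj: "\<And>h. D h = 0 \<Longrightarrow> h = 0"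
  shows "eventually (\<lambda>y. F y = F x \<longrightarrow> y = x) (nhds x)"
proof -
  have lin: "linear D" using F has_derivative_linear by blast
  then have "inj D" using inj by (simp add: linear_injective_0)
  with lin obtain B where B: "B > 0" "\<And>h. B * norm h \<le> norm (D h)"
    using linear_inj_bounded_below_pos by blast
  obtain \<delta> where "\<delta> > 0" and \<delta>: "\<And>y. norm (y - x) < \<delta> \<Longrightarrow> norm (F y - F x - D (y - x)) \<le> B / 2 * norm (y - x)"
    using F[unfolded has_derivative_at_alt] B(1) half_gt_zero by blast
  have "F y = F x \<longrightarrow> y = x" if "dist y x < \<delta>" for y
  proof
    assume "F y = F x"
    then have "norm (D (y - x)) \<le> B / 2 * norm (y - x)" using \<delta>[of y] that by (simp add: dist_norm)
    then have "B * norm (y - x) \<le> B / 2 * norm (y - x)" using B(2)[of "y - x"] by linarith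
    then show "y = x" using B(1) by (simp add: mult_le_cancel_right)
  qed
  then show ?thesis using \<open>\<delta> > 0\<close> eventually_nhds_metric by blast
qed

text \<open>
  The unknowns are the coordinates of two vectors \<open>\<alpha>, \<beta>\<close> in the normal space with \<open>u g\<^sub>\<alpha> + v g\<^sub>\<beta> = 0\<close>, where \<open>g\<^sub>\<alpha>\<close> and \<open>g\<^sub>\<beta>\<close> are
  the corresponding members of the pencil of quadratic forms on the line. The matrix of the system is the Sylvester
  matrix of the pencil, so its determinant is a multiple of the resultant.
\<close>

lemma linearized_equations_injective:
  fixes P1 P2 Q1 Q2 R1 R2 x y x' y' :: real
  assumes D: "(Q1\<^sup>2 - P1 * R1) * (Q2\<^sup>2 - P2 * R2) \<noteq> (Q1 * Q2 - (P1 * R2 + P2 * R1) / 2)\<^sup>2"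
    and "x * P1 + y * P2 = 0"
    and "2 * (x * Q1 + y * Q2) + (x' * P1 + y' * P2) = 0"
    and "x * R1 + y * R2 + 2 * (x' * Q1 + y' * Q2) = 0"
    and "x' * R1 + y' * R2 = 0"
  shows "x = 0 \<and> y = 0 \<and> x' = 0 \<and> y' = 0"
proof -
  have D0: "4 * ((Q1\<^sup>2 - P1 * R1) * (Q2\<^sup>2 - P2 * R2)) - (2 * Q1 * Q2 - (P1 * R2 + P2 * R1))\<^sup>2 \<noteq> 0" (is "?D \<noteq> 0")
    using D by (simp add: power2_eq_square field_simps)
  have "?D * x = 0" using assms(2-) by algebra
  moreover have "?D * y = 0" using assms(2-) by algebra
  moreover have "?D * x' = 0" using assms(2-) by algebra
  moreover have "?D * y' = 0" using assms(2-) by algebra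
  ultimately show ?thesis using D0 by simp
qed

text \<open>
  The planes near \<open>p\<close> are graphs over \<open>p\<close>: each has a unique basis \<open>a', b'\<close> that projects orthogonally
  to \<open>a, b\<close>. The first four equations say that \<open>f\<close> vanishes on the span of \<open>a'\<close> and \<open>b'\<close>, the other
  four normalize the basis. The derivative of the system at \<open>(a, b)\<close> is injective because the Segre
  form is non-degenerate, so that \<open>p\<close> is an isolated solution.
\<close>

lemma graph_equations_isolated:
  assumes f: "homogeneous 3 f" and ns: "nonsingular f" and o: "orthonormal4 a b c d"
    and p: "{u *\<^sub>R a + v *\<^sub>R b | u v. True} \<in> real_lines f"
  shows "eventually (\<lambda>(a', b'). polar f a' a' a' = 0 \<and> polar f a' a' b' = 0 \<and> polar f a' b' b' = 0 \<and>
      polar f b' b' b' = 0 \<and> a' \<bullet> a = 1 \<and> a' \<bullet> b = 0 \<and> b' \<bullet> a = 0 \<and> b' \<bullet> b = 1 \<longrightarrow> a' = a \<and> b' = b) (nhds (a, b))"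
proof -
  define F where "F = (\<lambda>z. (polar f (fst z) (fst z) (fst z), polar f (fst z) (fst z) (snd z),
     polar f (fst z) (snd z) (snd z), polar f (snd z) (snd z) (snd z),
     fst z \<bullet> a, fst z \<bullet> b, snd z \<bullet> a, snd z \<bullet> b))"
  define D where "D = (\<lambda>h. (polar f (fst h) a a + polar f a (fst h) a + polar f a a (fst h),
     polar f (fst h) a b + polar f a (fst h) b + polar f a a (snd h),
     polar f (fst h) b b + polar f a (snd h) b + polar f a b (snd h),
     polar f (snd h) b b + polar f b (snd h) b + polar f b b (snd h),
     fst h \<bullet> a, fst h \<bullet> b, snd h \<bullet> a, snd h \<bullet> b))"
  note B = orthonormal4_adapted_basis[OF o]
  have fs: "(fst has_derivative fst) (at (a, b))" "(snd has_derivative snd) (at (a, b))"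
    by (auto intro: bounded_linear_imp_has_derivative bounded_linear_fst bounded_linear_snd)
  have "(F has_derivative D) (at (a, b))"
    unfolding F_def D_def
    by (intro has_derivative_Pair has_derivative_eq_rhs[OF polar_has_derivative[OF f]] has_derivative_inner_left fs) (auto intro!: fs)
  moreover have "h = 0" if "D h = 0" for h
  proof -
    obtain \<alpha> \<beta> where h: "h = (\<alpha>, \<beta>)" by fastforce
    have normal: "\<alpha> \<bullet> a = 0" "\<alpha> \<bullet> b = 0" "\<beta> \<bullet> a = 0" "\<beta> \<bullet> b = 0"
      using that by (simp_all add: D_def h zero_prod_def)
    obtain x y x' y' where ex: "\<alpha> = x *\<^sub>R c + y *\<^sub>R d" "\<beta> = x' *\<^sub>R c + y' *\<^sub>R d"
      using orthonormal4_expand[OF o, of \<alpha>] orthonormal4_expand[OF o, of \<beta>]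
      unfolding normal scaleR_zero_left add_0_right by blast
    have c3: "polar f \<nu> s t = polar f s t \<nu>" "polar f s \<nu> t = polar f s t \<nu>" for \<nu> s t :: "real^4"
      by (simp_all add: polar_def algebra_simps)
    have "3 * polar f a a \<alpha> = 0" "2 * polar f a b \<alpha> + polar f a a \<beta> = 0"
      "polar f b b \<alpha> + 2 * polar f a b \<beta> = 0" "3 * polar f b b \<beta> = 0"
      using that by (simp_all add: D_def h zero_prod_def c3[where \<nu> = \<alpha>] c3[where \<nu> = \<beta>])
    then have "x = 0 \<and> y = 0 \<and> x' = 0 \<and> y' = 0"
      using segre_disc_neq_0[OF f ns p B]
      by (intro linearized_equations_injective[of "polar f a b c" "polar f a a c" "polar f b b c"
          "polar f a b d" "polar f a a d" "polar f b b d"])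
        (simp_all add: ex polar_linear[OF f] polar_real_linear[OF f] segre_disc_def segre_def segre_polar_def)
    then show ?thesis by (simp add: h ex zero_prod_def)
  qed
  ultimately have ev: "eventually (\<lambda>z. F z = F (a, b) \<longrightarrow> z = (a, b)) (nhds (a, b))"
    by (rule isolated_zero)
  have "a \<in> {u *\<^sub>R a + v *\<^sub>R b | u v. True}" "b \<in> {u *\<^sub>R a + v *\<^sub>R b | u v. True}"
    using adapted_basis_mem[OF B] by blast+
  then have "F (a, b) = (0, 0, 0, 0, 1, 0, 0, 1)"
    using polar_vanishes_on_line[OF p] o by (simp add: F_def orthonormal4_def inner_commute)
  then show ?thesis
    using ev by (auto elim!: eventually_mono simp: F_def)
qed

text \<open>
  A basis close to \<open>(a, b)\<close> of a line on the surface can be normalized as in the preceding lemma by a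
  linear substitution close to the identity, which does not leave the line.
\<close>

lemma real_lines_isolated:
  assumes f: "homogeneous 3 f" and ns: "nonsingular f"
    and ab: "a \<bullet> a = 1" "b \<bullet> b = 1" "a \<bullet> b = 0"
    and p: "{u *\<^sub>R a + v *\<^sub>R b | u v. True} \<in> real_lines f"
  shows "eventually (\<lambda>(a', b'). \<forall>p'\<in>real_lines f. a' \<in> p' \<longrightarrow> b' \<in> p' \<longrightarrow> a \<in> p' \<and> b \<in> p') (nhds (a, b))"
proof -
  obtain c d where o: "orthonormal4 a b c d" using orthonormal4_extend[OF ab] by blast
  define \<delta> where "\<delta> = (\<lambda>z. (fst z \<bullet> a) * (snd z \<bullet> b) - (fst z \<bullet> b) * (snd z \<bullet> a))"
  \<comment> \<open>The normalized basis, by Cramer's rule for the matrix of inner products with \<open>a\<close> and \<open>b\<close>.\<close>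
  define N where "N = (\<lambda>z. (inverse (\<delta> z) *\<^sub>R ((snd z \<bullet> b) *\<^sub>R fst z - (fst z \<bullet> b) *\<^sub>R snd z),
     inverse (\<delta> z) *\<^sub>R ((fst z \<bullet> a) *\<^sub>R snd z - (snd z \<bullet> a) *\<^sub>R fst z)))"
  have d1: "\<delta> (a, b) = 1" using ab by (simp add: \<delta>_def inner_commute)
  have cont: "isCont \<delta> (a, b)" unfolding \<delta>_def by (intro continuous_intros)
  have Nab: "N (a, b) = (a, b)" using ab d1 by (simp add: N_def inner_commute)
  have "isCont N (a, b)"
    unfolding N_def using d1 cont by (intro continuous_intros) auto
  then have lim: "filterlim N (nhds (a, b)) (nhds (a, b))"
    unfolding isCont_def Nab tendsto_at_iff_tendsto_nhds[of N "(a, b)", unfolded Nab] .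
  have "filterlim \<delta> (nhds 1) (nhds (a, b))"
    using cont unfolding isCont_def d1 tendsto_at_iff_tendsto_nhds[of \<delta> "(a, b)", unfolded d1] .
  then have nz: "eventually (\<lambda>z. \<delta> z \<noteq> 0) (nhds (a, b))"
    by (rule tendsto_imp_eventually_ne) simp
  show ?thesis
    using eventually_compose_filterlim[OF graph_equations_isolated[OF f ns o p] lim] nz
  proof eventually_elim
    case (elim z)
    obtain a' b' where z: "z = (a', b')" by fastforce
    define \<alpha> \<beta> where "\<alpha> = fst (N z)" "\<beta> = snd (N z)"
    note \<alpha>\<beta> = this
    have "\<delta> z \<noteq> 0" by fact
    have dual: "\<alpha> \<bullet> a = 1" "\<alpha> \<bullet> b = 0" "\<beta> \<bullet> a = 0" "\<beta> \<bullet> b = 1"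
    proof -
      have "\<alpha> \<bullet> a = inverse (\<delta> z) * \<delta> z" "\<beta> \<bullet> b = inverse (\<delta> z) * \<delta> z"
        unfolding \<alpha>\<beta> N_def by (simp_all add: inner_diff_left \<delta>_def mult.commute)
      then show "\<alpha> \<bullet> a = 1" "\<beta> \<bullet> b = 1" using \<open>\<delta> z \<noteq> 0\<close> by simp_all
      show "\<alpha> \<bullet> b = 0" "\<beta> \<bullet> a = 0"
        unfolding \<alpha>\<beta> N_def by (simp_all add: inner_diff_left mult.commute)
    qed
    have "a \<in> p' \<and> b \<in> p'" if p': "p' \<in> real_lines f" "a' \<in> p'" "b' \<in> p'" for p'
    proof -
      have "subspace p'" using p' by (simp add: real_lines_def)
      then have "\<alpha> \<in> p'" "\<beta> \<in> p'"
        unfolding \<alpha>\<beta> N_def z using p' by (auto intro!: subspace_scale subspace_diff)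
      then have "\<alpha> = a \<and> \<beta> = b"
        using elim(1) dual polar_vanishes_on_line[OF p'(1)] by (simp add: case_prod_unfold \<alpha>\<beta>)
      then show ?thesis using \<open>\<alpha> \<in> p'\<close> \<open>\<beta> \<in> p'\<close> by simp
    qed
    then show ?case unfolding z by blast
  qed
qed

lemma plane_of_orthonormal_pair:
  assumes ab: "a \<bullet> a = 1" "b \<bullet> b = 1" "(a::real^4) \<bullet> b = 0"
  shows "subspace {u *\<^sub>R a + v *\<^sub>R b | u v. True}" "dim {u *\<^sub>R a + v *\<^sub>R b | u v. True} = 2"
proof -
  have sp: "{u *\<^sub>R a + v *\<^sub>R b | u v. True} = span {a, b}"
    unfolding span_insert span_empty by (auto simp: algebra_simps)
  have "a \<noteq> b" using ab by auto
  moreover have "independent {a, b}"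
    by (rule pairwise_orthogonal_independent)
      (use ab in \<open>auto simp: pairwise_def orthogonal_def inner_commute\<close>)
  ultimately show "subspace {u *\<^sub>R a + v *\<^sub>R b | u v. True}" "dim {u *\<^sub>R a + v *\<^sub>R b | u v. True} = 2"
    unfolding sp by (simp_all add: dim_eq_card_independent)
qed

text \<open>
  Orthonormal bases of the lines on the surface form a compact set, so infinitely many lines would
  accumulate at another line on the surface, contrary to isolation.
\<close>

lemma finite_real_lines:
  assumes f: "homogeneous 3 f" and ns: "nonsingular f"
  shows "finite (real_lines f)"
proof (rule ccontr)
  assume inf: "infinite (real_lines f)"
  define K where "K = {z :: (real^4) \<times> (real^4). fst z \<bullet> fst z = 1 \<and> snd z \<bullet> snd z = 1 \<and> fst z \<bullet> snd z = 0 \<and>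
     (\<forall>u v. eval_poly f (u *\<^sub>R fst z + v *\<^sub>R snd z) = 0)}"
  have "compact K"
  proof -
    have "continuous_on UNIV (\<lambda>z::(real^4) \<times> (real^4). eval_poly f (u *\<^sub>R fst z + v *\<^sub>R snd z))" for u v and f :: poly4
    proof -
      have "(\<lambda>z::(real^4) \<times> (real^4). eval_poly f (u *\<^sub>R fst z + v *\<^sub>R snd z)) differentiable (at w)" for w
        by (intro eval_poly_differentiable bounded_linear_imp_differentiable bounded_linear_intros)
      then have "isCont (\<lambda>z::(real^4) \<times> (real^4). eval_poly f (u *\<^sub>R fst z + v *\<^sub>R snd z)) w" for w
        by (rule differentiable_imp_continuous_within)
      then show ?thesis by (simp add: continuous_at_imp_continuous_on)
    qed
    then have "closed K" unfolding K_def
      by (intro closed_Collect_conj closed_Collect_all closed_Collect_eq continuous_intros)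
    moreover have "K \<subseteq> cball 0 1 \<times> cball 0 1"
      by (auto simp: K_def norm_eq_sqrt_inner)
    then have "bounded K" by (rule bounded_subset[rotated]) (auto intro: bounded_Times)
    ultimately show ?thesis by (simp add: compact_eq_bounded_closed)
  qed
  define plane where "plane = (\<lambda>z :: (real^4) \<times> (real^4). {u *\<^sub>R fst z + v *\<^sub>R snd z | u v. True})"
  have "\<exists>z\<in>K. p = plane z" if "p \<in> real_lines f" for p
  proof -
    have "subspace p" "dim p = 2" "\<forall>x\<in>p. eval_poly f x = 0" using that by (auto simp: real_lines_def)
    obtain a b where "a \<bullet> a = 1" "b \<bullet> b = 1" "a \<bullet> b = 0" "p = {u *\<^sub>R a + v *\<^sub>R b | u v. True}"
      using \<open>subspace p\<close> \<open>dim p = 2\<close> by (rule orthonormal_pair)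
    then show ?thesis using \<open>\<forall>x\<in>p. eval_poly f x = 0\<close>
      by (intro bexI[of _ "(a, b)"]) (auto simp: K_def plane_def)
  qed
  then obtain g where g: "\<And>p. p \<in> real_lines f \<Longrightarrow> g p \<in> K \<and> p = plane (g p)" by metis
  then have "inj_on g (real_lines f)" by (metis inj_onI)
  then have "infinite (g ` real_lines f)" using inf finite_imageD by blast
  moreover have "g ` real_lines f \<subseteq> K" using g by blast
  ultimately obtain z where z: "z \<in> K" "z islimpt (g ` real_lines f)"
    using \<open>compact K\<close> compact_eq_Bolzano_Weierstrass by metis
  obtain a b where ab: "z = (a, b)" by fastforce
  have on: "a \<bullet> a = 1" "b \<bullet> b = 1" "a \<bullet> b = 0" using z(1) by (auto simp: K_def ab)
  have pl: "{u *\<^sub>R a + v *\<^sub>R b | u v. True} \<in> real_lines f"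
    using z(1) plane_of_orthonormal_pair[OF on] by (auto simp: K_def ab real_lines_def)
  obtain U where U: "open U" "(a, b) \<in> U"
    and iso: "\<forall>w\<in>U. case w of (a', b') \<Rightarrow>
      \<forall>p'\<in>real_lines f. a' \<in> p' \<longrightarrow> b' \<in> p' \<longrightarrow> a \<in> p' \<and> b \<in> p'"
    using real_lines_isolated[OF f ns on pl, unfolded eventually_nhds] by (elim exE conjE) (rule that)
  have "p' = plane z" if "p' \<in> real_lines f" "g p' \<in> U" for p'
  proof -
    have mem: "fst w \<in> plane w" "snd w \<in> plane w" for w
    proof -
      have "fst w = 1 *\<^sub>R fst w + 0 *\<^sub>R snd w" "snd w = 0 *\<^sub>R fst w + 1 *\<^sub>R snd w" by simp_all
      then show "fst w \<in> plane w" "snd w \<in> plane w" unfolding plane_def by blast+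
    qed
    have "a \<in> p' \<and> b \<in> p'"
      using bspec[OF iso that(2)] that(1) mem[of "g p'"] g[OF that(1)] by (simp add: case_prod_unfold)
    then have "plane z \<subseteq> p'"
      using that(1) by (auto simp: plane_def ab real_lines_def intro!: subspace_add subspace_scale)
    then show ?thesis
      using that(1) pl plane_of_orthonormal_pair[OF on]
      by (intro subspace_dim_equal[symmetric]) (auto simp: plane_def ab real_lines_def)
  qed
  then have "U \<inter> g ` real_lines f \<subseteq> {g (plane z)}" by auto
  then have "finite (U \<inter> g ` real_lines f)" by (rule finite_subset) simp
  then show False using z(2) U unfolding islimpt_eq_acc_point ab by blast
qed

section \<open>Determinants of real-linear endomorphisms\<close>

lemma det_4:
  "det (A::'a::comm_ring_1^4^4) =
    A$1$1 * (A$2$2 * (A$3$3 * A$4$4 - A$3$4 * A$4$3) - A$2$3 * (A$3$2 * A$4$4 - A$3$4 * A$4$2)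
      + A$2$4 * (A$3$2 * A$4$3 - A$3$3 * A$4$2))
  - A$1$2 * (A$2$1 * (A$3$3 * A$4$4 - A$3$4 * A$4$3) - A$2$3 * (A$3$1 * A$4$4 - A$3$4 * A$4$1)
      + A$2$4 * (A$3$1 * A$4$3 - A$3$3 * A$4$1))
  + A$1$3 * (A$2$1 * (A$3$2 * A$4$4 - A$3$4 * A$4$2) - A$2$2 * (A$3$1 * A$4$4 - A$3$4 * A$4$1)
      + A$2$4 * (A$3$1 * A$4$2 - A$3$2 * A$4$1))
  - A$1$4 * (A$2$1 * (A$3$2 * A$4$3 - A$3$3 * A$4$2) - A$2$2 * (A$3$1 * A$4$3 - A$3$3 * A$4$1)
      + A$2$3 * (A$3$1 * A$4$2 - A$3$2 * A$4$1))"
proof -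
  have f1: "finite {2::4, 3, 4}" "1 \<notin> {2::4, 3, 4}" by auto
  have f2: "finite {3::4, 4}" "2 \<notin> {3::4, 4}" by auto
  have f3: "finite {4::4}" "3 \<notin> {4::4}" by auto
  show ?thesis
    unfolding det_def UNIV_4
    unfolding sum_over_permutations_insert[OF f1]
    unfolding sum_over_permutations_insert[OF f2]
    unfolding sum_over_permutations_insert[OF f3]
    unfolding permutes_sing
    by (simp add: sign_swap_id permutation_swap_id sign_compose permutation_compose sign_id swap_id_eq algebra_simps)
qed

lemma of_real4_to_real4 [simp]: "of_real4 (to_real4 z) = z"
  by (simp add: of_real4_def to_real4_def vec_eq_iff forall_2 vector_def)

lemma linear_to_real4: "linear to_real4"
  by (rule linearI) (simp_all add: to_real4_def vec_eq_iff forall_4 vector_def)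

lemma linear_of_real4: "linear of_real4"
  by (rule linearI) (simp_all add: of_real4_def vec_eq_iff forall_2 vector_def complex_eq_iff)

lemma real_det_compose:
  assumes "linear E" "linear N"
  shows "real_det (\<lambda>h. E (N h)) = real_det E * real_det N"
proof -
  have lin: "linear (\<lambda>x. to_real4 (D (of_real4 x)))" if "linear D" for D
    using linear_compose[OF linear_compose[OF linear_of_real4 that] linear_to_real4] by (simp add: o_def)
  have "(\<lambda>x. to_real4 (E (N (of_real4 x)))) =
      (\<lambda>x. to_real4 (E (of_real4 x))) \<circ> (\<lambda>x. to_real4 (N (of_real4 x)))"
    by (simp add: o_def)
  then show ?thesis
    unfolding real_det_def using matrix_compose[OF lin[OF assms(2)] lin[OF assms(1)]]
    by (simp add: det_mul)
qed

lemma real_det_entries: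
  "real_det D = det (vector [vector [Re (D (vector [1, 0]) $ 1), Re (D (vector [\<i>, 0]) $ 1), Re (D (vector [0, 1]) $ 1), Re (D (vector [0, \<i>]) $ 1)],
     vector [Im (D (vector [1, 0]) $ 1), Im (D (vector [\<i>, 0]) $ 1), Im (D (vector [0, 1]) $ 1), Im (D (vector [0, \<i>]) $ 1)],
     vector [Re (D (vector [1, 0]) $ 2), Re (D (vector [\<i>, 0]) $ 2), Re (D (vector [0, 1]) $ 2), Re (D (vector [0, \<i>]) $ 2)],
     vector [Im (D (vector [1, 0]) $ 2), Im (D (vector [\<i>, 0]) $ 2), Im (D (vector [0, 1]) $ 2), Im (D (vector [0, \<i>]) $ 2)]] :: real^4^4)"
proof -
  have ax: "of_real4 (axis 1 1) = vector [1, 0]" "of_real4 (axis 2 1) = vector [\<i>, 0]"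
    "of_real4 (axis 3 1) = vector [0, 1]" "of_real4 (axis 4 1) = vector [0, \<i>]"
    by (simp_all add: of_real4_def axis_def complex_eq_iff vec_eq_iff forall_2 vector_def)
  show ?thesis
    unfolding real_det_def
    by (rule arg_cong[of _ _ det]) (simp add: matrix_def vec_eq_iff forall_4 ax to_real4_def vector_def)
qed

text \<open>
  A complex-linear change of coordinates preserves the complex orientation.
\<close>

lemma real_det_complex_linear:
  "real_det (\<lambda>h. (N::complex^2^2) *v h) = (cmod (det N))\<^sup>2"
  unfolding real_det_entries det_4 det_2 cmod_power2
  by (simp add: matrix_vector_mult_def sum_2 vector_def algebra_simps power2_eq_square)

text \<open>
  This is the shape of the derivative of the section, in terms of the two normal coordinates. Its
  determinant turns out to be \<open>- 4 k\<^sup>4\<close> times the Gram determinant of the quadratic form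
  \<open>|\<alpha>\<^sub>1 x + \<alpha>\<^sub>2 y|\<^sup>2 - (\<beta>\<^sub>1 x + \<beta>\<^sub>2 y)\<^sup>2\<close>, which is Segre's form again. The proof is a comparison of
  polynomials in the real and imaginary parts.
\<close>

lemma real_det_normal_form:
  fixes \<alpha>1 \<alpha>2 :: complex and \<beta>1 \<beta>2 k :: real
  shows "real_det (\<lambda>n. vector [k * (\<alpha>1 * n $ 1 + \<alpha>2 * n $ 2),
      k * (\<alpha>1 * cnj (n $ 1) + \<alpha>2 * cnj (n $ 2) + 2 * (\<beta>1 * n $ 1 + \<beta>2 * n $ 2))])
    = - 4 * k ^ 4 * (((cmod \<alpha>1)\<^sup>2 - \<beta>1\<^sup>2) * ((cmod \<alpha>2)\<^sup>2 - \<beta>2\<^sup>2) - (Re (cnj \<alpha>1 * \<alpha>2) - \<beta>1 * \<beta>2)\<^sup>2)"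
proof -
  obtain a b c d where \<alpha>: "\<alpha>1 = Complex a b" "\<alpha>2 = Complex c d" by (metis complex_surj)
  show ?thesis
    unfolding \<alpha> real_det_entries det_4 cmod_power2
    by (simp add: vector_def, simp add: algebra_simps power2_eq_square power4_eq_xxxx)
qed

section \<open>The derivative of the section in a holomorphic frame\<close>

lemma bounded_linear_vector_scale: "bounded_linear (\<lambda>c::complex. c *s (v::complex^'n))"
  by (intro linear_conv_bounded_linear[THEN iffD1] linearI) (simp_all add: vec_eq_iff algebra_simps)

lemma bounded_linear_vector_scale_right: "bounded_linear (\<lambda>v. (c::complex) *s (v::complex^'n))"
  by (intro linear_conv_bounded_linear[THEN iffD1] linearI) (simp_all add: vec_eq_iff algebra_simps)

lemma bounded_linear_real_part: "bounded_linear real_part"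
  by (intro linear_conv_bounded_linear[THEN iffD1] linearI) (simp_all add: real_part_def vec_eq_iff)

lemma bounded_linear_conj_vec: "bounded_linear conj_vec"
  by (intro linear_conv_bounded_linear[THEN iffD1] linearI) (simp_all add: conj_vec_def vec_eq_iff)

lemma complexify_real_part: "complexify (real_part z) = (1 / 2) *s (z + conj_vec z)"
  by (simp add: complexify_def real_part_def conj_vec_def vec_eq_iff complex_eq_iff)

text \<open>
  Since \<open>Re(t \<zeta>) = (t \<zeta> + cnj (t \<zeta>)) / 2\<close>, the trilinear expansion has eight terms, which form conjugate
  pairs. With \<open>\<eta> = \<zeta>\<close> this gives the coordinates of the section in the frame \<open>\<zeta>\<close>, and for general
  \<open>\<eta>\<close> the coordinates of its derivative.
\<close>

lemma polar_real_part:
  assumes f: "homogeneous 3 f"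
  shows "polar f (real_part (t *s \<zeta>)) (real_part (t *s \<zeta>)) (real_part (t *s \<eta>)) =
    Re (polar f \<zeta> \<zeta> \<eta> / 4 * t ^ 3
      + (polar f \<zeta> \<zeta> (conj_vec \<eta>) + 2 * polar f \<zeta> (conj_vec \<zeta>) \<eta>) / 4 * t\<^sup>2 * cnj t)"
proof -
  define X where "X = polar f \<zeta> \<zeta> \<eta> / 4 * t ^ 3
      + (polar f \<zeta> \<zeta> (conj_vec \<eta>) + 2 * polar f \<zeta> (conj_vec \<zeta>) \<eta>) / 4 * t\<^sup>2 * cnj t"
  have comm: "polar f (conj_vec \<zeta>) \<zeta> \<theta> = polar f \<zeta> (conj_vec \<zeta>) \<theta>" for \<theta> by (rule polar_commute)
  have conj: "polar f (conj_vec \<zeta>) (conj_vec \<zeta>) (conj_vec \<eta>) = cnj (polar f \<zeta> \<zeta> \<eta>)"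
    "polar f (conj_vec \<zeta>) (conj_vec \<zeta>) \<eta> = cnj (polar f \<zeta> \<zeta> (conj_vec \<eta>))"
    "polar f \<zeta> (conj_vec \<zeta>) (conj_vec \<eta>) = cnj (polar f \<zeta> (conj_vec \<zeta>) \<eta>)"
    by (simp_all flip: polar_conj add: comm)
  have "complex_of_real (polar f (real_part (t *s \<zeta>)) (real_part (t *s \<zeta>)) (real_part (t *s \<eta>)))
      = (X + cnj X) / 2"
    unfolding polar_complexify[symmetric] complexify_real_part conj_vec_simps polar_linear[OF f] comm conj X_def
    by (simp add: field_simps power2_eq_square power3_eq_cube)
  also have "\<dots> = of_real (Re X)" by (simp add: complex_add_cnj)
  finally show ?thesis unfolding X_def of_real_eq_iff .
qed

text \<open>
  The map from \<open>(a, b)\<close> to real binary cubic forms is a real isomorphism; four values of \<open>t\<close> suffice to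
  recover the four real coordinates.
\<close>

lemma cubic_form_coefficients_unique:
  fixes a b a' b' :: complex
  assumes "\<And>t. Re (a * t^3 + b * t\<^sup>2 * cnj t) = Re (a' * t^3 + b' * t\<^sup>2 * cnj t)"
  shows "a = a'" "b = b'"
proof -
  obtain a1 a2 b1 b2 where ab: "a = Complex a1 a2" "b = Complex b1 b2" by (metis complex_surj)
  obtain a1' a2' b1' b2' where ab': "a' = Complex a1' a2'" "b' = Complex b1' b2'" by (metis complex_surj)
  have "a = a' \<and> b = b'"
    using assms[of 1] assms[of \<i>] assms[of "Complex 1 1"] assms[of "Complex 1 (-1)"]
    unfolding ab ab' by (simp add: power2_eq_square power3_eq_cube algebra_simps)
  then show "a = a'" "b = b'" by simp_all
qed

text \<open>
  Differentiating \<open>f (Re (t \<zeta>(w)))\<close> with respect to \<open>w\<close> for every fixed \<open>t\<close> determines the derivative of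
  the section, since its coordinates are determined by all these functions together. No formula for
  the section near \<open>w\<close> enters.
\<close>

lemma section_derivative:
  assumes f: "homogeneous 3 f" and U: "open U" "w \<in> U"
    and \<zeta>: "(\<zeta> has_derivative \<zeta>') (at w)" and \<sigma>: "section_in_frame f U \<zeta> \<sigma>" "(\<sigma> has_derivative D) (at w)"
  shows "D h $ 1 = 3 / 4 * polar f (\<zeta> w) (\<zeta> w) (\<zeta>' h)"
    and "D h $ 2 = 3 / 4 * (polar f (\<zeta> w) (\<zeta> w) (conj_vec (\<zeta>' h)) + 2 * polar f (\<zeta> w) (conj_vec (\<zeta> w)) (\<zeta>' h))"
proof -
  have "Re (D h $ 1 * t^3 + D h $ 2 * t\<^sup>2 * cnj t) =
    Re (3 / 4 * polar f (\<zeta> w) (\<zeta> w) (\<zeta>' h) * t^3 +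
       3 / 4 * (polar f (\<zeta> w) (\<zeta> w) (conj_vec (\<zeta>' h)) + 2 * polar f (\<zeta> w) (conj_vec (\<zeta> w)) (\<zeta>' h)) * t\<^sup>2 * cnj t)" for t
  proof -
    have "((\<lambda>w. real_part (t *s \<zeta> w)) has_derivative (\<lambda>h. real_part (t *s \<zeta>' h))) (at w)"
      by (intro bounded_linear.has_derivative[OF bounded_linear_real_part]
          bounded_linear.has_derivative[OF bounded_linear_vector_scale_right] \<zeta>)
    from has_derivative_compose[OF this eval_poly_has_derivative[OF f]]
    have 1: "((\<lambda>w. eval_poly f (real_part (t *s \<zeta> w))) has_derivative
      (\<lambda>h. 3 * polar f (real_part (t *s \<zeta> w)) (real_part (t *s \<zeta> w)) (real_part (t *s \<zeta>' h)))) (at w)" .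
    have "((\<lambda>w. \<sigma> w $ i) has_derivative (\<lambda>h. D h $ i)) (at w)" for i
      by (rule bounded_linear.has_derivative[OF bounded_linear_vec_nth \<sigma>(2)])
    then have "((\<lambda>w. Re (\<sigma> w $ 1 * t^3 + \<sigma> w $ 2 * t\<^sup>2 * cnj t)) has_derivative
      (\<lambda>h. Re (D h $ 1 * t^3 + D h $ 2 * t\<^sup>2 * cnj t))) (at w)"
      by (intro has_derivative_Re has_derivative_add has_derivative_mult_left)
    then have 2: "((\<lambda>w. eval_poly f (real_part (t *s \<zeta> w))) has_derivative
      (\<lambda>h. Re (D h $ 1 * t^3 + D h $ 2 * t\<^sup>2 * cnj t))) (at w)"
      by (rule has_derivative_transform_within_open[OF _ U])
        (use \<sigma>(1) in \<open>simp add: section_in_frame_def\<close>)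
    have "Re (D h $ 1 * t^3 + D h $ 2 * t\<^sup>2 * cnj t) =
       3 * polar f (real_part (t *s \<zeta> w)) (real_part (t *s \<zeta> w)) (real_part (t *s \<zeta>' h))"
      using fun_cong[OF has_derivative_unique[OF 2 1], of h] .
    also have "\<dots> = Re (3 * (polar f (\<zeta> w) (\<zeta> w) (\<zeta>' h) / 4 * t ^ 3
      + (polar f (\<zeta> w) (\<zeta> w) (conj_vec (\<zeta>' h)) + 2 * polar f (\<zeta> w) (conj_vec (\<zeta> w)) (\<zeta>' h)) / 4 * t\<^sup>2 * cnj t))"
      unfolding polar_real_part[OF f] by simp
    also have "\<dots> = Re (3 / 4 * polar f (\<zeta> w) (\<zeta> w) (\<zeta>' h) * t^3 +
       3 / 4 * (polar f (\<zeta> w) (\<zeta> w) (conj_vec (\<zeta>' h)) + 2 * polar f (\<zeta> w) (conj_vec (\<zeta> w)) (\<zeta>' h)) * t\<^sup>2 * cnj t)"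
      by (rule arg_cong[of _ _ Re]) (simp add: field_simps)
    finally show ?thesis .
  qed
  from cubic_form_coefficients_unique[OF this]
  show "D h $ 1 = 3 / 4 * polar f (\<zeta> w) (\<zeta> w) (\<zeta>' h)"
    and "D h $ 2 = 3 / 4 * (polar f (\<zeta> w) (\<zeta> w) (conj_vec (\<zeta>' h)) + 2 * polar f (\<zeta> w) (conj_vec (\<zeta> w)) (\<zeta>' h))"
    by blast+
qed

section \<open>The local Euler number of a line\<close>

text \<open>
  The complex bilinear (not Hermitian) extension of the inner product, whose null vectors are the
  points of the quadric.
\<close>

definition bdot :: "complex^4 \<Rightarrow> complex^4 \<Rightarrow> complex" where
  "bdot z w = (\<Sum>i\<in>UNIV. z $ i * w $ i)"

lemma bdot_simps [simp]:
  "bdot (z + z') w = bdot z w + bdot z' w" "bdot w (z + z') = bdot w z + bdot w z'"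
  "bdot (c *s z) w = c * bdot z w" "bdot w (c *s z) = c * bdot w z"
  "bdot 0 z = 0"
  by (simp_all add: bdot_def algebra_simps sum.distrib sum_distrib_left)

lemma bdot_diff [simp]:
  "bdot (z - z') w = bdot z w - bdot z' w" "bdot w (z - z') = bdot w z - bdot w z'"
  by (simp_all add: bdot_def algebra_simps sum_subtractf)

lemma bdot_commute: "bdot z w = bdot w z"
  by (simp add: bdot_def mult.commute)

lemma bdot_complexify: "bdot (complexify x) (complexify y) = of_real (x \<bullet> y)"
  by (simp add: bdot_def complexify_def inner_vec_def)

lemma orthonormal4_bdot:
  assumes "orthonormal4 a b c d"
  shows "bdot (complexify a) (complexify a) = 1" "bdot (complexify b) (complexify b) = 1"
    "bdot (complexify c) (complexify c) = 1" "bdot (complexify d) (complexify d) = 1"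
    "bdot (complexify a) (complexify b) = 0" "bdot (complexify b) (complexify a) = 0"
    "bdot (complexify a) (complexify c) = 0" "bdot (complexify c) (complexify a) = 0"
    "bdot (complexify a) (complexify d) = 0" "bdot (complexify d) (complexify a) = 0"
    "bdot (complexify b) (complexify c) = 0" "bdot (complexify c) (complexify b) = 0"
    "bdot (complexify b) (complexify d) = 0" "bdot (complexify d) (complexify b) = 0"
    "bdot (complexify c) (complexify d) = 0" "bdot (complexify d) (complexify c) = 0"
  using assms by (simp_all add: bdot_complexify orthonormal4_def inner_commute)

lemma orthonormal4_complex_expand:
  assumes "orthonormal4 a b c d"
  shows "z = bdot z (complexify c) *s complexify c + bdot z (complexify d) *s complexify d
    + (bdot z (complexify a) *s complexify a + bdot z (complexify b) *s complexify b)" (is "z = ?r")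
proof -
  have "?r $ i = z $ i" for i
  proof -
    have "?r $ i = (\<Sum>j\<in>UNIV. z $ j * of_real (a $ i * a $ j + b $ i * b $ j + c $ i * c $ j + d $ i * d $ j))"
      by (simp add: bdot_def complexify_def sum_distrib_right sum_distrib_left sum.distrib[symmetric] algebra_simps)
    also have "\<dots> = (\<Sum>j\<in>UNIV. z $ j * (if i = j then 1 else 0))"
      unfolding orthonormal4_completeness[OF assms] by (simp add: if_distrib cong: if_cong)
    also have "\<dots> = z $ i" by (simp add: if_distrib cong: if_cong)
    finally show ?thesis .
  qed
  then show ?thesis by (simp add: vec_eq_iff)
qed

lemma real_part_scale:
  "real_part (t *s (complexify x + \<i> *s complexify y)) = Re t *\<^sub>R x + (- Im t) *\<^sub>R y"
  by (simp add: real_part_def complexify_def vec_eq_iff algebra_simps)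

lemma plane_of_complex_frame:
  "plane_of (complexify x + \<i> *s complexify y) = {u *\<^sub>R x + v *\<^sub>R y | u v. True}"
proof -
  have "\<exists>t. u *\<^sub>R x + v *\<^sub>R y = Re t *\<^sub>R x + (- Im t) *\<^sub>R y" for u v
    by (rule exI[of _ "Complex u (- v)"]) simp
  then show ?thesis unfolding plane_of_def real_part_scale by blast
qed

lemma plane_of_scale:
  assumes "k \<noteq> 0"
  shows "plane_of (k *s z) = plane_of z"
proof -
  have sub: "plane_of (k *s z) \<subseteq> plane_of z" for k z
  proof
    fix x assume "x \<in> plane_of (k *s z)"
    then obtain t where "x = real_part ((t * k) *s z)" by (auto simp: plane_of_def vector_smult_assoc)
    then show "x \<in> plane_of z" unfolding plane_of_def by (rule range_eqI)
  qed
  have "z = inverse k *s (k *s z)" using assms by (simp add: vector_smult_assoc)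
  then have "plane_of z \<subseteq> plane_of (k *s z)" using sub[of "inverse k" "k *s z"] by simp
  with sub[of k z] show ?thesis by blast
qed

text \<open>
  The real and imaginary parts of a null vector are orthogonal and of equal length. This is the
  correspondence between points of the quadric and oriented planes.
\<close>

lemma isotropic_normal_form:
  assumes iso: "(\<Sum>i\<in>UNIV. (z $ i)\<^sup>2) = 0" and "dim (plane_of z) = 2"
  obtains \<rho> a b c d where "\<rho> > 0" "orthonormal4 a b c d"
    "z = of_real \<rho> *s (complexify a + \<i> *s complexify b)"
    "plane_of z = {u *\<^sub>R a + v *\<^sub>R b | u v. True}"
proof -
  define x y where "x = real_part z" "y = real_part (- \<i> *s z)"
  have z: "z = complexify x + \<i> *s complexify y"
    by (simp add: x_y_def complexify_def real_part_def vec_eq_iff complex_eq_iff)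
  have "bdot z z = 0" using iso by (simp add: bdot_def power2_eq_square)
  then have "complex_of_real (x \<bullet> x) - of_real (y \<bullet> y) + 2 * \<i> * of_real (x \<bullet> y) = 0"
    unfolding z by (simp add: bdot_complexify inner_commute algebra_simps)
  then have xy: "x \<bullet> x = y \<bullet> y" "x \<bullet> y = 0"
    by (simp_all add: complex_eq_iff)
  have "x \<noteq> 0"
  proof
    assume "x = 0"
    then have "y = 0" using xy by simp
    then have "plane_of z = {0}" using \<open>x = 0\<close> unfolding z plane_of_complex_frame by simp
    then show False using assms(2) by simp
  qed
  define \<rho> where "\<rho> = norm x"
  have \<rho>: "\<rho> > 0" "x \<bullet> x = \<rho>\<^sup>2" "y \<bullet> y = \<rho>\<^sup>2"
    unfolding xy(1)[symmetric] using \<open>x \<noteq> 0\<close> by (simp_all add: \<rho>_def power2_norm_eq_inner)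
  define a b where "a = inverse \<rho> *\<^sub>R x" "b = inverse \<rho> *\<^sub>R y"
  have "a \<bullet> a = 1" "b \<bullet> b = 1" "a \<bullet> b = 0"
    using \<rho> xy by (simp_all add: a_b_def power2_eq_square field_simps)
  then obtain c d where o: "orthonormal4 a b c d" using orthonormal4_extend by blast
  have "x = \<rho> *\<^sub>R a" "y = \<rho> *\<^sub>R b" using \<rho>(1) by (simp_all add: a_b_def)
  then have za: "z = of_real \<rho> *s (complexify a + \<i> *s complexify b)"
    unfolding z by (simp add: complexify_scale vector_add_ldistrib vector_smult_assoc mult.commute)
  have "plane_of z = {u *\<^sub>R a + v *\<^sub>R b | u v. True}"
    unfolding za using \<rho>(1) by (subst plane_of_scale) (simp_all add: plane_of_complex_frame)
  then show ?thesis using that \<rho>(1) o za by blast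
qed

text \<open>
  The derivative of \<open>\<zeta> \<cdot> \<zeta> = 0\<close>.
\<close>

lemma holomorphic_frame_tangent:
  assumes U: "open U" "w \<in> U" and iso: "\<And>w. w \<in> U \<Longrightarrow> (\<Sum>i\<in>UNIV. (\<zeta> w $ i)\<^sup>2) = 0"
    and \<zeta>: "(\<zeta> has_derivative \<zeta>') (at w)"
  shows "bdot (\<zeta> w) (\<zeta>' h) = 0"
proof -
  have comp: "((\<lambda>w. \<zeta> w $ i) has_derivative (\<lambda>h. \<zeta>' h $ i)) (at w)" for i
    by (rule bounded_linear.has_derivative[OF bounded_linear_vec_nth \<zeta>])
  have 1: "((\<lambda>w. \<Sum>i\<in>UNIV. \<zeta> w $ i * \<zeta> w $ i) has_derivative
      (\<lambda>h. \<Sum>i\<in>UNIV. \<zeta> w $ i * \<zeta>' h $ i + \<zeta>' h $ i * \<zeta> w $ i)) (at w)"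
    by (intro has_derivative_sum has_derivative_mult comp)
  have 2: "((\<lambda>w. \<Sum>i\<in>UNIV. \<zeta> w $ i * \<zeta> w $ i) has_derivative (\<lambda>h. 0)) (at w)"
    by (rule has_derivative_transform_within_open[OF has_derivative_const[of 0] U])
      (use iso in \<open>simp add: power2_eq_square\<close>)
  have "(\<Sum>i\<in>UNIV. \<zeta> w $ i * \<zeta>' h $ i + \<zeta>' h $ i * \<zeta> w $ i) = 0"
    using fun_cong[OF has_derivative_unique[OF 1 2], of h] .
  then show ?thesis by (simp add: bdot_def mult.commute flip: mult_2 sum_distrib_left)
qed

lemma polar_complex_frame:
  assumes f: "homogeneous 3 f"
  shows "polar f (of_real \<rho> *s (complexify a + \<i> *s complexify b)) (of_real \<rho> *s (complexify a + \<i> *s complexify b)) (complexify \<nu>)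
      = of_real (\<rho>\<^sup>2) * Complex (polar f a a \<nu> - polar f b b \<nu>) (2 * polar f a b \<nu>)"
    and "polar f (of_real \<rho> *s (complexify a + \<i> *s complexify b)) (conj_vec (of_real \<rho> *s (complexify a + \<i> *s complexify b))) (complexify \<nu>)
      = of_real (\<rho>\<^sup>2 * (polar f a a \<nu> + polar f b b \<nu>))"
  unfolding conj_vec_simps polar_linear[OF f] polar_complexify polar_commute(1)[of f b a]
  by (simp_all add: complex_eq_iff power2_eq_square algebra_simps)

text \<open>
  The tangent vectors of the quadric at \<open>\<zeta>\<close> are, modulo \<open>\<zeta>\<close> itself, the complex combinations
  \<open>n\<^sub>1 c + n\<^sub>2 d\<close> of an orthonormal basis of the normal space of \<open>p\<close>. Because \<open>T\<close> vanishes on \<open>p\<close>, the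
  derivative of the section sees only \<open>(n\<^sub>1, n\<^sub>2)\<close>, and as a function of it has the normal form computed
  above with \<open>\<alpha> = T(\<zeta>, \<zeta>, \<cdot>)\<close> and \<open>\<beta> = T(\<zeta>, cnj \<zeta>, \<cdot>)\<close>. The passage from the coordinates of the
  frame to \<open>(n\<^sub>1, n\<^sub>2)\<close> is complex linear and invertible, hence preserves orientation. In total
  the Jacobian determinant is a negative multiple of the Gram determinant of Segre's form, whatever
  the frame; so the sign is \<open>1\<close> where this form is indefinite and \<open>-1\<close> where it is definite.
\<close>

lemma real_det_section:
  assumes f: "homogeneous 3 f" and ns: "nonsingular f" and p: "p \<in> real_lines f"
    and fr: "holomorphic_frame U \<zeta>" and w: "w \<in> U" "plane_of (\<zeta> w) = p"
    and \<sigma>: "section_in_frame f U \<zeta> \<sigma>" "(\<sigma> has_derivative D) (at w)"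
  shows "sgn (real_det D) = (if hyperbolic f p then 1 else - 1)"
proof -
  have U: "open U" and iso: "\<And>w. w \<in> U \<Longrightarrow> (\<Sum>i\<in>UNIV. (\<zeta> w $ i)\<^sup>2) = 0"
    using fr unfolding holomorphic_frame_def by blast+
  obtain M :: "complex^2^4" where M: "(\<zeta> has_derivative (\<lambda>h. M *v h)) (at w)"
    and imm: "\<And>k h. k *s \<zeta> w + M *v h = 0 \<Longrightarrow> k = 0 \<and> h = 0"
    using fr w(1) unfolding holomorphic_frame_def by blast
  have "dim (plane_of (\<zeta> w)) = 2" using w(2) p by (simp add: real_lines_def)
  then obtain \<rho> a b c d where \<rho>: "\<rho> > 0" and o: "orthonormal4 a b c d"
    and \<zeta>w: "\<zeta> w = of_real \<rho> *s (complexify a + \<i> *s complexify b)"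
    and "plane_of (\<zeta> w) = {u *\<^sub>R a + v *\<^sub>R b | u v. True}"
    using isotropic_normal_form[OF iso[OF w(1)]] by blast
  then have pab: "p = {u *\<^sub>R a + v *\<^sub>R b | u v. True}" using w(2) by simp
  note B = orthonormal4_adapted_basis[OF o, folded pab]
  have van: "polar f s t r = 0" if "s \<in> {a, b}" "t \<in> {a, b}" "r \<in> {a, b}" for s t r
    using that adapted_basis_mem[OF B] polar_vanishes_on_line[OF p] by auto
  have vanC: "polar f (\<zeta> w) (\<zeta> w) (\<zeta> w) = 0" "polar f (\<zeta> w) (\<zeta> w) (conj_vec (\<zeta> w)) = 0"
    "polar f (\<zeta> w) (conj_vec (\<zeta> w)) (\<zeta> w) = 0"
    unfolding \<zeta>w conj_vec_simps polar_linear[OF f] polar_complexify by (simp_all add: van)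
  \<comment> \<open>The matrix from the coordinates of the frame to the normal coordinates \<open>(n\<^sub>1, n\<^sub>2)\<close>.\<close>
  define N :: "complex^2^2" where "N = (\<chi> i j. if i = 1 then bdot (column j M) (complexify c) else bdot (column j M) (complexify d))"
  have N: "(N *v h) $ 1 = bdot (M *v h) (complexify c)" "(N *v h) $ 2 = bdot (M *v h) (complexify d)" for h
    by (simp_all add: N_def bdot_def matrix_vector_mult_def sum_2 column_def sum_distrib_left
        sum_distrib_right sum.distrib algebra_simps)
  have decomp: "\<exists>k. M *v h = k *s \<zeta> w + ((N *v h) $ 1 *s complexify c + (N *v h) $ 2 *s complexify d)" for h
  proof -
    let ?\<eta> = "M *v h"
    have "bdot (\<zeta> w) ?\<eta> = 0" by (rule holomorphic_frame_tangent[OF U w(1) iso M])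
    then have "of_real \<rho> * (bdot ?\<eta> (complexify a) + \<i> * bdot ?\<eta> (complexify b)) = 0"
      unfolding \<zeta>w by (simp add: bdot_commute algebra_simps)
    then have "bdot ?\<eta> (complexify a) + \<i> * bdot ?\<eta> (complexify b) = 0"
      using \<rho> by simp
    then have "bdot ?\<eta> (complexify b) = \<i> * bdot ?\<eta> (complexify a)"
      by (simp add: complex_eq_iff)
    then have "bdot ?\<eta> (complexify a) *s complexify a + bdot ?\<eta> (complexify b) *s complexify b
       = (bdot ?\<eta> (complexify a) / of_real \<rho>) *s \<zeta> w"
      using \<rho> unfolding \<zeta>w by (simp add: vec_eq_iff algebra_simps)
    then have "?\<eta> = (bdot ?\<eta> (complexify a) / of_real \<rho>) *s \<zeta> w
        + ((N *v h) $ 1 *s complexify c + (N *v h) $ 2 *s complexify d)"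
      using orthonormal4_complex_expand[OF o, of ?\<eta>] unfolding N by (simp add: add.commute)
    then show ?thesis by blast
  qed
  have "det N \<noteq> 0"
  proof -
    have "h = 0" if "N *v h = 0" for h
    proof -
      obtain k where "M *v h = k *s \<zeta> w + ((N *v h) $ 1 *s complexify c + (N *v h) $ 2 *s complexify d)"
        using decomp by blast
      then have "M *v h = k *s \<zeta> w" unfolding that by simp
      then have "(- k) *s \<zeta> w + M *v h = 0" by (simp add: vec_eq_iff)
      then show ?thesis using imm by blast
    qed
    then show ?thesis
      by (metis invertible_det_nz invertible_left_inverse matrix_left_invertible_ker)
  qed
  define \<alpha> where "\<alpha> = (\<lambda>\<nu>. of_real (\<rho>\<^sup>2) * Complex (polar f a a \<nu> - polar f b b \<nu>) (2 * polar f a b \<nu>))"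
  define \<beta> where "\<beta> = (\<lambda>\<nu>. \<rho>\<^sup>2 * (polar f a a \<nu> + polar f b b \<nu>))"
  define E :: "complex^2 \<Rightarrow> complex^2" where "E = (\<lambda>n. vector [of_real (3 / 4) * (\<alpha> c * n $ 1 + \<alpha> d * n $ 2),
      of_real (3 / 4) * (\<alpha> c * cnj (n $ 1) + \<alpha> d * cnj (n $ 2) + 2 * (of_real (\<beta> c) * n $ 1 + of_real (\<beta> d) * n $ 2))])"
  have \<alpha>: "polar f (\<zeta> w) (\<zeta> w) (complexify \<nu>) = \<alpha> \<nu>"
    and \<beta>: "polar f (\<zeta> w) (conj_vec (\<zeta> w)) (complexify \<nu>) = of_real (\<beta> \<nu>)" for \<nu>
    unfolding \<zeta>w \<alpha>_def \<beta>_def by (rule polar_complex_frame[OF f])+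
  have "D h = E (N *v h)" for h
  proof -
    obtain k where k: "M *v h = k *s \<zeta> w + ((N *v h) $ 1 *s complexify c + (N *v h) $ 2 *s complexify d)"
      using decomp by blast
    show ?thesis
      using section_derivative[OF f U w(1) M \<sigma>, of h]
      unfolding k conj_vec_simps polar_linear[OF f] vanC \<alpha> \<beta>
      by (simp add: vec_eq_iff forall_2 E_def vector_def algebra_simps)
  qed
  then have D: "D = (\<lambda>h. E (N *v h))" by blast
  have "linear E"
    by (rule linearI) (simp_all add: E_def vec_eq_iff forall_2 vector_def field_simps scaleR_conv_of_real[where 'a = complex])
  moreover have "linear (\<lambda>h. N *v h)"
    by (rule linearI) (simp_all add: matrix_vector_mult_def vec_eq_iff sum_2 algebra_simps scaleR_conv_of_real[where 'a = complex])
  ultimately have "real_det D = real_det E * (cmod (det N))\<^sup>2"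
    unfolding D by (simp add: real_det_compose real_det_complex_linear)
  also have "real_det E = - 4 * (3 / 4) ^ 4 * (((cmod (\<alpha> c))\<^sup>2 - (\<beta> c)\<^sup>2) * ((cmod (\<alpha> d))\<^sup>2 - (\<beta> d)\<^sup>2)
      - (Re (cnj (\<alpha> c) * \<alpha> d) - \<beta> c * \<beta> d)\<^sup>2)"
    unfolding E_def by (rule real_det_normal_form)
  also have "\<dots> = - (4 * (3 / 4) ^ 4 * 16 * \<rho> ^ 8) * segre_disc f a b c d"
  proof -
    have 1: "(cmod (\<alpha> \<nu>))\<^sup>2 - (\<beta> \<nu>)\<^sup>2 = 4 * \<rho> ^ 4 * segre f a b \<nu>" for \<nu>
      unfolding cmod_power2 \<alpha>_def \<beta>_def segre_def by (simp add: algebra_simps power2_eq_square power4_eq_xxxx)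
    have 2: "Re (cnj (\<alpha> \<mu>) * \<alpha> \<nu>) - \<beta> \<mu> * \<beta> \<nu> = 4 * \<rho> ^ 4 * segre_polar f a b \<mu> \<nu>" for \<mu> \<nu>
      unfolding \<alpha>_def \<beta>_def segre_polar_def by (simp add: algebra_simps power2_eq_square power4_eq_xxxx)
    have "\<rho> ^ 8 = \<rho> ^ 4 * \<rho> ^ 4" by (simp flip: power_add)
    then show ?thesis
      unfolding 1 2 segre_disc_def by (simp add: algebra_simps power2_eq_square)
  qed
  finally have "real_det D = - ((4 * (3 / 4) ^ 4 * 16 * \<rho> ^ 8 * (cmod (det N))\<^sup>2) * segre_disc f a b c d)"
    by (simp add: algebra_simps)
  moreover have "4 * (3 / 4) ^ 4 * 16 * \<rho> ^ 8 * (cmod (det N))\<^sup>2 > 0" using \<rho> \<open>det N \<noteq> 0\<close> by simp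
  moreover have "sgn (- (k * x)) = - sgn x" if "k > 0" for k x :: real
    using that by (simp add: sgn_mult)
  ultimately have "sgn (real_det D) = - sgn (segre_disc f a b c d)"
    by presburger
  then show ?thesis
    using line_type_iff_segre_disc(1)[OF f p B] segre_disc_neq_0[OF f ns p B] by simp
qed

section \<open>A holomorphic frame through a given plane\<close>

text \<open>
  The affine chart of the quadric inverse to the stereographic projection: with \<open>e = a + i b\<close> and its
  conjugate \<open>e'\<close>, which pair to 2, the vector \<open>e + w\<^sub>1 c + w\<^sub>2 d + \<lambda> e'\<close> is null exactly for
  \<open>\<lambda> = - (w\<^sub>1\<^sup>2 + w\<^sub>2\<^sup>2) / 4\<close>. It is polynomial in \<open>w\<close>, so the frame exists on all of \<open>\<complex>\<^sup>2\<close>.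
\<close>

lemma holomorphic_frame_exists:
  assumes f: "homogeneous 3 f" and p: "subspace p" "dim p = 2"
  obtains U \<zeta> \<sigma> w D where "holomorphic_frame U \<zeta>" "w \<in> U" "plane_of (\<zeta> w) = p"
    "section_in_frame f U \<zeta> \<sigma>" "(\<sigma> has_derivative D) (at w)"
proof -
  obtain a b where ab: "a \<bullet> a = 1" "b \<bullet> b = 1" "a \<bullet> b = 0" and pab: "p = {u *\<^sub>R a + v *\<^sub>R b | u v. True}"
    using p by (rule orthonormal_pair)
  obtain c d where o: "orthonormal4 a b c d" using orthonormal4_extend[OF ab] by blast
  note dots = orthonormal4_bdot[OF o]
  define e e' where "e = complexify a + \<i> *s complexify b" "e' = complexify a - \<i> *s complexify b"
  have ee: "bdot e e = 0" "bdot e' e' = 0" "bdot e e' = 2" "bdot e' e = 2"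
    "bdot e (complexify c) = 0" "bdot e (complexify d) = 0" "bdot e' (complexify c) = 0" "bdot e' (complexify d) = 0"
    "bdot (complexify c) e = 0" "bdot (complexify d) e = 0" "bdot (complexify c) e' = 0" "bdot (complexify d) e' = 0"
    by (simp_all add: e_e'_def dots)
  define \<zeta> where "\<zeta> = (\<lambda>w::complex^2. e + (w $ 1 *s complexify c + w $ 2 *s complexify d)
      + (- ((w $ 1)\<^sup>2 + (w $ 2)\<^sup>2) / 4) *s e')"
  define m1 where "m1 = (\<lambda>w::complex^2. complexify c + (- (w $ 1) / 2) *s e')"
  define m2 where "m2 = (\<lambda>w::complex^2. complexify d + (- (w $ 2) / 2) *s e')"
  define M :: "complex^2 \<Rightarrow> complex^2^4" where "M = (\<lambda>w. \<chi> i j. if j = 1 then m1 w $ i else m2 w $ i)"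
  have Mv: "M w *v h = h $ 1 *s m1 w + h $ 2 *s m2 w" for w h
    by (simp add: M_def matrix_vector_mult_def sum_2 vec_eq_iff algebra_simps)
  have der: "(\<zeta> has_derivative (\<lambda>h. M w *v h)) (at w)" for w
  proof -
    have nth: "((\<lambda>w::complex^2. w $ i) has_derivative (\<lambda>h. h $ i)) (at w)" for i
      by (rule bounded_linear_imp_has_derivative[OF bounded_linear_vec_nth])
    have quad: "((\<lambda>w::complex^2. - ((w $ 1)\<^sup>2 + (w $ 2)\<^sup>2) / 4) has_derivative
        (\<lambda>h. - (w $ 1 * h $ 1 + w $ 2 * h $ 2) / 2)) (at w)"
      by (auto intro!: derivative_eq_intros nth simp: fun_eq_iff field_simps)
    have "(\<zeta> has_derivative (\<lambda>h. 0 + (h $ 1 *s complexify c + h $ 2 *s complexify d)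
        + (- (w $ 1 * h $ 1 + w $ 2 * h $ 2) / 2) *s e')) (at w)"
      unfolding \<zeta>_def
      by (intro has_derivative_add has_derivative_const quad nth
          bounded_linear.has_derivative[OF bounded_linear_vector_scale])
    moreover have "0 + (h $ 1 *s complexify c + h $ 2 *s complexify d)
        + (- (w $ 1 * h $ 1 + w $ 2 * h $ 2) / 2) *s e' = M w *v h" for h
      unfolding Mv m1_def m2_def by (simp add: vec_eq_iff field_simps)
    ultimately show ?thesis by simp
  qed
  have coord: "bdot (\<zeta> w) e' = 2" "bdot (\<zeta> w) (complexify c) = w $ 1" "bdot (\<zeta> w) (complexify d) = w $ 2" for w
    unfolding \<zeta>_def by (simp_all add: ee dots)
  have Mcoord: "bdot (M w *v h) e' = 0" "bdot (M w *v h) (complexify c) = h $ 1" "bdot (M w *v h) (complexify d) = h $ 2" for w h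
    unfolding Mv m1_def m2_def by (simp_all add: ee dots)
  have "holomorphic_frame UNIV \<zeta>"
    unfolding holomorphic_frame_def
  proof (intro conjI ballI allI impI)
    show "(\<Sum>i\<in>UNIV. (\<zeta> w $ i)\<^sup>2) = 0" for w
    proof -
      have "(\<Sum>i\<in>UNIV. (\<zeta> w $ i)\<^sup>2) = bdot (\<zeta> w) (\<zeta> w)" by (simp add: bdot_def power2_eq_square)
      also have "\<dots> = 0" unfolding \<zeta>_def by (simp add: ee dots field_simps power2_eq_square)
      finally show ?thesis .
    qed
    show "w' = w" if "\<zeta> w' = k *s \<zeta> w" for w w' k
    proof -
      have "bdot (\<zeta> w') v = k * bdot (\<zeta> w) v" for v using that by simp
      from this[of e'] this[of "complexify c"] this[of "complexify d"]
      show ?thesis by (simp add: coord vec_eq_iff forall_2)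
    qed
    show "\<exists>M'. (\<zeta> has_derivative (*v) M') (at w) \<and> (\<forall>k h. k *s \<zeta> w + M' *v h = 0 \<longrightarrow> k = 0 \<and> h = 0)" for w
    proof (intro exI conjI allI impI)
      show "(\<zeta> has_derivative (*v) (M w)) (at w)" by (rule der)
      fix k h assume "k *s \<zeta> w + M w *v h = 0"
      then have *: "bdot (k *s \<zeta> w + M w *v h) v = 0" for v by simp
      show "k = 0" using *[of e'] by (simp add: coord Mcoord)
      then show "h = 0" using *[of "complexify c"] *[of "complexify d"]
        by (simp add: coord Mcoord vec_eq_iff forall_2)
    qed
  qed auto
  moreover have "plane_of (\<zeta> 0) = p"
    by (simp add: \<zeta>_def e_e'_def plane_of_complex_frame pab)
  moreover define \<sigma> where "\<sigma> = (\<lambda>w. (polar f (\<zeta> w) (\<zeta> w) (\<zeta> w) / 4) *s axis 1 1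
      + (3 * polar f (\<zeta> w) (\<zeta> w) (conj_vec (\<zeta> w)) / 4) *s axis 2 1 :: complex^2)"
  have "section_in_frame f UNIV \<zeta> \<sigma>"
    unfolding section_in_frame_def
  proof (intro ballI allI)
    fix w and t :: complex
    have "eval_poly f (real_part (t *s \<zeta> w)) = Re (polar f (\<zeta> w) (\<zeta> w) (\<zeta> w) / 4 * t ^ 3
      + (polar f (\<zeta> w) (\<zeta> w) (conj_vec (\<zeta> w)) + 2 * polar f (\<zeta> w) (conj_vec (\<zeta> w)) (\<zeta> w)) / 4 * t\<^sup>2 * cnj t)"
      unfolding polar_diag[OF f, symmetric] by (rule polar_real_part[OF f])
    also have "\<dots> = Re (\<sigma> w $ 1 * t ^ 3 + \<sigma> w $ 2 * t\<^sup>2 * cnj t)"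
      unfolding \<sigma>_def polar_commute(2)[of f "\<zeta> w" "conj_vec (\<zeta> w)" "\<zeta> w"]
      by (rule arg_cong[of _ _ Re]) (simp add: axis_def)
    finally show "eval_poly f (real_part (t *s \<zeta> w)) = Re (\<sigma> w $ 1 * t ^ 3 + \<sigma> w $ 2 * t\<^sup>2 * cnj t)" .
  qed
  moreover have "\<sigma> differentiable (at 0)"
  proof -
    have d\<zeta>: "\<zeta> differentiable (at 0)" using der unfolding differentiable_def by blast
    have dc: "(\<lambda>w. conj_vec (\<zeta> w)) differentiable (at 0)"
      using bounded_linear.has_derivative[OF bounded_linear_conj_vec der] unfolding differentiable_def by blast
    have dp: "(\<lambda>w. polar f (x w) (y w) (z w)) differentiable (at 0)"
      if "x differentiable (at 0)" "y differentiable (at 0)" "z differentiable (at 0)" for x y z :: "complex^2 \<Rightarrow> complex^4"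
      unfolding polar_def divide_inverse
      by (intro differentiable_mult differentiable_add differentiable_diff differentiable_const
          eval_poly_differentiable that)
    have ds: "(\<lambda>w. g w *s v) differentiable (at 0)" if g: "g differentiable (at 0)"
      for g :: "complex^2 \<Rightarrow> complex" and v :: "complex^2"
      using g bounded_linear.has_derivative[OF bounded_linear_vector_scale] unfolding differentiable_def by blast
    show ?thesis unfolding \<sigma>_def divide_inverse
      by (intro differentiable_add ds differentiable_mult differentiable_const dp d\<zeta> dc)
  qed
  then obtain D where "(\<sigma> has_derivative D) (at 0)" unfolding differentiable_def by blast
  ultimately show ?thesis using that by blast
qed

section \<open>Indices and line types\<close>

text \<open>
  The description by a unique sign is meaningful because the sign of the Jacobian determinant is the
  same for all frames, and at least one frame exists.
\<close>

lemma local_euler_number_eq: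
  assumes f: "homogeneous 3 f" and ns: "nonsingular f" and p: "p \<in> real_lines f"
  shows "local_euler_number f p = (if hyperbolic f p then 1 else - 1)"
  unfolding local_euler_number_def
proof (rule the_equality)
  have "subspace p" "dim p = 2" using p by (auto simp: real_lines_def)
  then obtain U \<zeta> \<sigma> w D where fr: "holomorphic_frame U \<zeta>" "w \<in> U" "plane_of (\<zeta> w) = p"
    "section_in_frame f U \<zeta> \<sigma>" "(\<sigma> has_derivative D) (at w)"
    by (rule holomorphic_frame_exists[OF f])
  moreover have "of_int (if hyperbolic f p then 1 else - 1) = sgn (real_det D)"
    using real_det_section[OF f ns p fr] by simp
  ultimately show "\<exists>U \<zeta> \<sigma> w D. holomorphic_frame U \<zeta> \<and> w \<in> U \<and> plane_of (\<zeta> w) = p \<and>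
      section_in_frame f U \<zeta> \<sigma> \<and> (\<sigma> has_derivative D) (at w) \<and>
      of_int (if hyperbolic f p then 1 else - 1) = sgn (real_det D)"
    by blast
next
  fix s :: int
  assume "\<exists>U \<zeta> \<sigma> w D. holomorphic_frame U \<zeta> \<and> w \<in> U \<and> plane_of (\<zeta> w) = p \<and>
      section_in_frame f U \<zeta> \<sigma> \<and> (\<sigma> has_derivative D) (at w) \<and> of_int s = sgn (real_det D)"
  then have "real_of_int s = (if hyperbolic f p then 1 else - 1)"
    using real_det_section[OF f ns p] by metis
  then show "s = (if hyperbolic f p then 1 else - 1)" by (simp split: if_splits)
qed

text \<open>
  On a singular surface there could be a third possibility, a degenerate Segre form.
\<close>

lemma elliptic_iff_not_hyperbolic:
  assumes f: "homogeneous 3 f" and ns: "nonsingular f" and p: "p \<in> real_lines f"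
  shows "elliptic f p \<longleftrightarrow> \<not> hyperbolic f p"
proof -
  have "subspace p" "dim p = 2" using p by (auto simp: real_lines_def)
  then obtain a b where ab: "a \<bullet> a = 1" "b \<bullet> b = 1" "a \<bullet> b = 0" and pab: "p = {u *\<^sub>R a + v *\<^sub>R b | u v. True}"
    by (rule orthonormal_pair)
  obtain c d where o: "orthonormal4 a b c d" using orthonormal4_extend[OF ab] by blast
  note B = orthonormal4_adapted_basis[OF o, folded pab]
  show ?thesis
    using line_type_iff_segre_disc[OF f p B] segre_disc_neq_0[OF f ns p B] by auto
qed

theorem proposition4p1p1:
  fixes f :: poly4
  assumes "homogeneous 3 f"
    and "nonsingular f"
  shows "finite (real_lines f) \<and>
         card {l \<in> real_lines f. hyperbolic f l} =
           card {l \<in> real_lines f. local_euler_number f l = 1} \<and>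
         card {l \<in> real_lines f. elliptic f l} =
           card {l \<in> real_lines f. local_euler_number f l = -1}"
proof -
  have "{l \<in> real_lines f. hyperbolic f l} = {l \<in> real_lines f. local_euler_number f l = 1}"
    "{l \<in> real_lines f. elliptic f l} = {l \<in> real_lines f. local_euler_number f l = -1}"
    by (auto simp: local_euler_number_eq[OF assms] elliptic_iff_not_hyperbolic[OF assms] split: if_splits)
  then show ?thesis using finite_real_lines[OF assms] by simp
qed

end
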